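(* Let $\mathbf{k}$ be an algebraically closed field of characteristic zero and let $\mathbf{A}$ be a $2$-dimensional conservative algebra over $\mathbf{k}$ with nonzero multiplication. Then $\mathbf{A}$ is isomorphic to one of the following non-isomorphic algebras. Each algebra has basis $e_1,e_2$, and products of basis vectors that are not listed are zero: - $\mathfrak{C}_{01}$: $e_1e_1=e_1+e_2,\ e_1e_2=e_2$; - $\mathfrak{C}_{02}$: $e_1e_1=e_1+e_2,\ e_1e_2=2e_2,\ e_2e_1=-e_2$; - $\mathfrak{C}_{03}$: $e_1e_1=e_2,\ e_1e_2=e_2,\ e_2e_1=-e_2$; - $\mathfrak{C}_{04}$: $e_1e_1=e_2$; - $\mathfrak{C}_{05}(\alpha)$, $\alpha\in\mathbf{k}$: $e_1e_2=(1-\alpha)e_1,\ e_2e_1=\alpha e_1$; - $\mathfrak{C}_{06}$: $e_1e_2=e_2,\ e_2e_1=-e_2$; - $\mathfrak{C}_{07}$: $e_1e_1=e_2,\ e_2e_1=e_1,\ e_2e_2=e_2$; - $\mathfrak{C}_{08}$: $e_1e_1=e_1,\ e_1e_2=e_1$; - $\mathfrak{C}_{09}$: $e_1e_1=e_1,\ e_1e_2=e_2,\ e_2e_1=e_1-e_2$; - $\mathfrak{C}_{10}(\alpha,\beta)$, $(\alpha,\beta)\in\mathbf{k}^2\setminus\mathcal{T}$: $e_1e_1=e_1,\ e_1e_2=\alpha e_2,\ e_2e_1=\beta e_2$; - $\mathfrak{C}_{11}(\alpha,\beta)$, $(0,\alpha,\beta,0)\in\mathcal{V}$: $e_1e_1=e_1,\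 e_1e_2=\alpha e_2,\ e_2e_1=\beta e_1,\ e_2e_2=e_2$; - $\mathfrak{C}_{12}(\alpha)$, $\alpha\in\mathbf{k}\setminus\{0\}$: $e_1e_1=e_1,\ e_1e_2=e_2,\ e_2e_1=e_1+\alpha e_2,\ e_2e_2=e_2$; - $\mathfrak{C}_{13}(\alpha)$, $\alpha\in\mathbf{k}\setminus\{1\}$: $e_1e_1=e_1,\ e_1e_2=\alpha e_2,\ e_2e_1=e_1,\ e_2e_2=e_2$; - $\mathfrak{C}_{14}(\alpha)$, $\alpha\in\mathbf{k}^*_{>1}$: $e_1e_1=e_1,\ e_1e_2=e_2,\ e_2e_1=\alpha e_1+\frac{1-\alpha}{\alpha}e_2,\ e_2e_2=e_2$; - $\mathfrak{C}_{15}(\alpha)$, $\alpha\in\mathbf{k}^*_{>1}$: $e_1e_1=e_1,\ e_1e_2=(\alpha-1)e_1+\frac1\alpha e_2,\ e_2e_1=e_1,\ e_2e_2=e_2$; - $\mathfrak{C}_{16}$: $e_1e_1=e_1,\ e_1e_2=-e_1,\ e_2e_1=-e_2,\ e_2e_2=e_2$; - $\mathfrak{C}_{17}(\alpha)$, $\alpha\in\mathbf{k}$: $e_1e_1=e_1,\ e_1e_2=(1-\alpha)e_1+\alpha e_2,\ e_2e_1=\alpha e_1+(1-\alpha)e_2,\ e_2e_2=e_2$.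
   Context: An algebra $(\mathbb{V},\mathcal{P})$ is a vector space $\mathbb{V}$ over $\mathbf{k}$ with a bilinear multiplication $\mathcal{P}:\mathbb{V}\times\mathbb{V}\to\mathbb{V}$ (no identities assumed). $L_x^{\mathcal{P}}$ denotes left multiplication by $x$: $L_x^{\mathcal P}(y)=\mathcal{P}(x,y)$. For a linear map $\mathcal{A}:\mathbb V\to\mathbb V$ and a bilinear map $\mathcal{B}:\mathbb V\times\mathbb V\to\mathbb V$, $[\mathcal{A},\mathcal{B}]$ is the bilinear map $$[\mathcal{A},\mathcal{B}](x,y)=\mathcal{A}(\mathcal{B}(x,y))-\mathcal{B}(\mathcal{A}(x),y)-\mathcal{B}(x,\mathcal{A}(y)).$$ Conservative algebra: $(\mathbb{V},\mathcal{P})$ is conservative if there exists a bilinear map $\mathcal{F}:\mathbb V\times\mathbb V\to\mathbb V$ such that for all $a,b\in\mathbb V$ $$[L_b^{\mathcal{P}},[L_a^{\mathcal{P}},\mathcal{P}]]=-[L^{\mathcal{P}}_{\mathcal{F}(a,b)},\mathcal{P}].$$ Parameter sets. $\mathbf{k}^*_{>1}$ is a fixed set of representatives of the orbits of the involution $\alpha\mapsto\alpha^{-1}$ on $\mathbf{k}\setminus\{0,1\}$. Let $\mathcal{T}=\{(\alpha,\beta)\in\mathbf{k}^2\mid\alpha+\beta=1\}$. For $\Gamma=(\alpha,\beta,\gamma,\delta)\in\mathbf{k}^4$ put $\mathcal{D}(\Gamma)=(\alpha+\gamma)(\beta+\delta)-1$, $\mathcal{C}_1(\Gamma)=(\beta,\delta)$,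 $\mathcal{C}_2(\Gamma)=(\gamma,\alpha)$, and, if $\mathcal{D}(\Gamma)\neq0$, $$\mathcal{C}_3(\Gamma)=\left(\frac{\beta\gamma-(\alpha-1)(\delta-1)}{\mathcal{D}(\Gamma)},\frac{\alpha\delta-(\beta-1)(\gamma-1)}{\mathcal{D}(\Gamma)}\right).$$ The symmetric group $S_3$ acts by permuting the three entries on the set of triples $(\mathcal{C}_1(\Gamma),\mathcal{C}_2(\Gamma),\mathcal{C}_3(\Gamma))$ with $\mathcal{D}(\Gamma)\ne0$ and $\mathcal{C}_1(\Gamma),\mathcal{C}_2(\Gamma)\notin\mathcal{T}$. There is a set $\tilde{\mathcal{V}}$ of representatives of the orbits of this action such that if $(\mathcal{C}_1,\mathcal{C}_2,\mathcal{C}_3)\in\tilde{\mathcal{V}}$ and $\mathcal{C}_1\neq\mathcal{C}_2$, then $\mathcal{C}_3\neq\mathcal{C}_1,\mathcal{C}_2$; fix such a $\tilde{\mathcal V}$. Then $$\mathcal{V}=\{\Gamma\in\mathbf{k}^4\mid\mathcal{D}(\Gamma)\neq0;\ \mathcal{C}_1(\Gamma),\mathcal{C}_2(\Gamma)\notin\mathcal{T};\ (\mathcal{C}_1(\Gamma),\mathcal{C}_2(\Gamma),\mathcal{C}_3(\Gamma))\in\tilde{\mathcal{V}}\}.$$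
   Formalization: The list gains a missing algebra e1e1=e1, e1e2=e2, e2e1=e1, e2e2=0; C14(-1) and C15(-1) are isomorphic and are the only coincidence; coverage assumes the representatives are chosen so that (0,a,b,0) or (0,b,a,0) lies in V for all generic (a,b), as it fails otherwise. *)

theory Defs
  imports "HOL-Analysis.Cartesian_Space" "HOL-Computational_Algebra.Polynomial"
begin

section \<open>Algebras, conservativity, isomorphism\<close>

definition bilinear_mult :: "('k::field \<Rightarrow> 'v::ab_group_add \<Rightarrow> 'v) \<Rightarrow> ('v \<Rightarrow> 'v \<Rightarrow> 'v) \<Rightarrow> bool" where
  "bilinear_mult s B \<longleftrightarrow>
     (\<forall>x. Vector_Spaces.linear s s (\<lambda>y. B x y)) \<and> (\<forall>y. Vector_Spaces.linear s s (\<lambda>x. B x y))"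

definition algebra_on :: "('k::field \<Rightarrow> 'v::ab_group_add \<Rightarrow> 'v) \<Rightarrow> ('v \<Rightarrow> 'v \<Rightarrow> 'v) \<Rightarrow> bool" where
  "algebra_on s P \<longleftrightarrow> vector_space s \<and> bilinear_mult s P"

definition left_mult :: "('v \<Rightarrow> 'v \<Rightarrow> 'v) \<Rightarrow> 'v \<Rightarrow> 'v \<Rightarrow> 'v" where
  "left_mult P x = (\<lambda>y. P x y)"

definition bracket :: "('v \<Rightarrow> 'v) \<Rightarrow> ('v \<Rightarrow> 'v \<Rightarrow> 'v) \<Rightarrow> 'v \<Rightarrow> 'v \<Rightarrow> 'v::ab_group_add" where
  "bracket A B = (\<lambda>x y. A (B x y) - B (A x) y - B x (A y))"

definition conservative :: "('k::field \<Rightarrow> 'v::ab_group_add \<Rightarrow> 'v) \<Rightarrow> ('v \<Rightarrow> 'v \<Rightarrow> 'v) \<Rightarrow> bool" where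
  "conservative s P \<longleftrightarrow>
     (\<exists>F. bilinear_mult s F \<and>
       (\<forall>a b. bracket (left_mult P b) (bracket (left_mult P a) P) =
              (\<lambda>x y. - bracket (left_mult P (F a b)) P x y)))"

definition algebra_iso ::
  "('k::field \<Rightarrow> 'v::ab_group_add \<Rightarrow> 'v) \<Rightarrow> ('v \<Rightarrow> 'v \<Rightarrow> 'v) \<Rightarrow>
   ('k \<Rightarrow> 'w::ab_group_add \<Rightarrow> 'w) \<Rightarrow> ('w \<Rightarrow> 'w \<Rightarrow> 'w) \<Rightarrow> bool" where
  "algebra_iso s P t Q \<longleftrightarrow>
     (\<exists>f. Vector_Spaces.linear s t f \<and> bij f \<and> (\<forall>x y. f (P x y) = Q (f x) (f y)))"

section \<open>Parameter sets\<close>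

text \<open>\<^term>\<open>R\<close> contains exactly one element of each of the orbits \<^term>\<open>orb x\<close>, for \<^term>\<open>x \<in> X\<close>.\<close>

definition orbit_reps :: "'a set \<Rightarrow> ('a \<Rightarrow> 'a set) \<Rightarrow> 'a set \<Rightarrow> bool" where
  "orbit_reps X orb R \<longleftrightarrow> R \<subseteq> X \<and> (\<forall>x\<in>X. \<exists>!r. r \<in> R \<and> r \<in> orb x)"

definition inversion_reps :: "'k::field set \<Rightarrow> bool" where
  "inversion_reps K \<longleftrightarrow> orbit_reps (UNIV - {0, 1}) (\<lambda>a. {a, inverse a}) K"

definition calT :: "('k::field \<times> 'k) set" where
  "calT = {(a, b). a + b = 1}"

fun calD :: "'k::field \<times> 'k \<times> 'k \<times> 'k \<Rightarrow> 'k" where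
  "calD (\<alpha>, \<beta>, \<gamma>, \<delta>) = (\<alpha> + \<gamma>) * (\<beta> + \<delta>) - 1"

fun calC1 :: "'k::field \<times> 'k \<times> 'k \<times> 'k \<Rightarrow> 'k \<times> 'k" where
  "calC1 (\<alpha>, \<beta>, \<gamma>, \<delta>) = (\<beta>, \<delta>)"

fun calC2 :: "'k::field \<times> 'k \<times> 'k \<times> 'k \<Rightarrow> 'k \<times> 'k" where
  "calC2 (\<alpha>, \<beta>, \<gamma>, \<delta>) = (\<gamma>, \<alpha>)"

text \<open>Only meaningful where \<^const>\<open>calD\<close> does not vanish.\<close>

fun calC3 :: "'k::field \<times> 'k \<times> 'k \<times> 'k \<Rightarrow> 'k \<times> 'k" where
  "calC3 (\<alpha>, \<beta>, \<gamma>, \<delta>) =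
     ((\<beta> * \<gamma> - (\<alpha> - 1) * (\<delta> - 1)) / calD (\<alpha>, \<beta>, \<gamma>, \<delta>),
      (\<alpha> * \<delta> - (\<beta> - 1) * (\<gamma> - 1)) / calD (\<alpha>, \<beta>, \<gamma>, \<delta>))"

type_synonym 'k triple = "('k \<times> 'k) \<times> ('k \<times> 'k) \<times> ('k \<times> 'k)"

definition triple_of :: "'k::field \<times> 'k \<times> 'k \<times> 'k \<Rightarrow> 'k triple" where
  "triple_of \<Gamma> = (calC1 \<Gamma>, calC2 \<Gamma>, calC3 \<Gamma>)"

definition generic_params :: "('k::field \<times> 'k \<times> 'k \<times> 'k) set" where
  "generic_params = {\<Gamma>. calD \<Gamma> \<noteq> 0 \<and> calC1 \<Gamma> \<notin> calT \<and> calC2 \<Gamma> \<notin> calT}"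

fun orb3 :: "'a \<times> 'a \<times> 'a \<Rightarrow> ('a \<times> 'a \<times> 'a) set" where
  "orb3 (a, b, c) = {(a, b, c), (a, c, b), (b, a, c), (b, c, a), (c, a, b), (c, b, a)}"

text \<open>The admissible choices of the set of representatives of the orbits of triples.\<close>

definition triple_reps :: "'k::field triple set \<Rightarrow> bool" where
  "triple_reps W \<longleftrightarrow> orbit_reps (triple_of ` generic_params) orb3 W \<and>
     (\<forall>(c1, c2, c3)\<in>W. c1 \<noteq> c2 \<longrightarrow> c3 \<noteq> c1 \<and> c3 \<noteq> c2)"

definition calV :: "'k::field triple set \<Rightarrow> ('k \<times> 'k \<times> 'k \<times> 'k) set" where
  "calV W = {\<Gamma>. calD \<Gamma> \<noteq> 0 \<and> calC1 \<Gamma> \<notin> calT \<and> calC2 \<Gamma> \<notin> calT \<and> triple_of \<Gamma> \<in> W}"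

text \<open>
  The orbit of the triple of \<open>(0, a, b, 0)\<close> consists of the permutations of
  \<open>((a, 0), (b, 0), (1, x))\<close> with \<open>x \<noteq> 0\<close>.  An admissible set of representatives may pick, say,
  \<open>((1, x), (a, 0), (b, 0))\<close> from it, and then neither \<open>(0, a, b, 0)\<close> nor \<open>(0, b, a, 0)\<close> lies in
  \<^const>\<open>calV\<close>.  The following condition selects the choices for which this does not happen;
  such choices exist, see \<open>adapted_triple_reps_exist\<close> below.
\<close>

definition adapted_reps :: "'k::field triple set \<Rightarrow> bool" where
  "adapted_reps W \<longleftrightarrow>
     (\<forall>a b. (0, a, b, 0) \<in> generic_params \<longrightarrow> (0, a, b, 0) \<in> calV W \<or> (0, b, a, 0) \<in> calV W)"

section \<open>The algebras of the classification\<close>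

text \<open>
  The multiplication on \<open>k\<^sup>2\<close> whose products of basis vectors
  \<open>e\<^sub>1e\<^sub>1\<close>, \<open>e\<^sub>1e\<^sub>2\<close>, \<open>e\<^sub>2e\<^sub>1\<close>, \<open>e\<^sub>2e\<^sub>2\<close> are the four arguments, in this order.
\<close>

definition mult_table ::
  "'k::field ^ 2 \<Rightarrow> 'k ^ 2 \<Rightarrow> 'k ^ 2 \<Rightarrow> 'k ^ 2 \<Rightarrow> 'k ^ 2 \<Rightarrow> 'k ^ 2 \<Rightarrow> 'k ^ 2" where
  "mult_table p11 p12 p21 p22 = (\<lambda>x y.
     (x $ 1 * y $ 1) *s p11 + (x $ 1 * y $ 2) *s p12 + (x $ 2 * y $ 1) *s p21 + (x $ 2 * y $ 2) *s p22)"

abbreviation e1 :: "'k::field ^ 2" where "e1 \<equiv> axis 1 1"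
abbreviation e2 :: "'k::field ^ 2" where "e2 \<equiv> axis 2 1"

datatype 'k label =
    C01 | C02 | C03 | C04 | C05 'k | C06 | C07 | C08 | C09 | C10 'k 'k | C11 'k 'k
  | C12 'k | C13 'k | C14 'k | C15 'k | C16 | C17 'k

fun calg :: "'k::field label \<Rightarrow> 'k ^ 2 \<Rightarrow> 'k ^ 2 \<Rightarrow> 'k ^ 2" where
  "calg C01       = mult_table (e1 + e2) e2 0 0"
| "calg C02       = mult_table (e1 + e2) (2 *s e2) (- e2) 0"
| "calg C03       = mult_table e2 e2 (- e2) 0"
| "calg C04       = mult_table e2 0 0 0"
| "calg (C05 \<alpha>)   = mult_table 0 ((1 - \<alpha>) *s e1) (\<alpha> *s e1) 0"
| "calg C06       = mult_table 0 e2 (- e2) 0"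
| "calg C07       = mult_table e2 0 e1 e2"
| "calg C08       = mult_table e1 e1 0 0"
| "calg C09       = mult_table e1 e2 (e1 - e2) 0"
| "calg (C10 \<alpha> \<beta>) = mult_table e1 (\<alpha> *s e2) (\<beta> *s e2) 0"
| "calg (C11 \<alpha> \<beta>) = mult_table e1 (\<alpha> *s e2) (\<beta> *s e1) e2"
| "calg (C12 \<alpha>)   = mult_table e1 e2 (e1 + \<alpha> *s e2) e2"
| "calg (C13 \<alpha>)   = mult_table e1 (\<alpha> *s e2) e1 e2"
| "calg (C14 \<alpha>)   = mult_table e1 e2 (\<alpha> *s e1 + ((1 - \<alpha>) / \<alpha>) *s e2) e2"
| "calg (C15 \<alpha>)   = mult_table e1 ((\<alpha> - 1) *s e1 + (1 / \<alpha>) *s e2) e1 e2"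
| "calg C16       = mult_table e1 (- e1) (- e2) e2"
| "calg (C17 \<alpha>)   = mult_table e1 ((1 - \<alpha>) *s e1 + \<alpha> *s e2) (\<alpha> *s e1 + (1 - \<alpha>) *s e2) e2"

text \<open>
  Exchanging \<open>e1\<close> and \<open>e2\<close> turns \<open>C14 \<alpha>\<close> into \<open>C15 (1 / \<alpha>)\<close>.  The element \<open>-1\<close> is fixed by
  inversion, so it lies in every admissible \<open>K\<close>, and \<open>C14 (-1)\<close>, \<open>C15 (-1)\<close> are isomorphic.
\<close>

fun listed :: "'k::field set \<Rightarrow> 'k triple set \<Rightarrow> 'k label \<Rightarrow> bool" where
  "listed K W (C10 \<alpha> \<beta>) \<longleftrightarrow> (\<alpha>, \<beta>) \<notin> calT"
| "listed K W (C11 \<alpha> \<beta>) \<longleftrightarrow> (0, \<alpha>, \<beta>, 0) \<in> calV W"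
| "listed K W (C12 \<alpha>) \<longleftrightarrow> \<alpha> \<noteq> 0"
| "listed K W (C13 \<alpha>) \<longleftrightarrow> \<alpha> \<noteq> 1"
| "listed K W (C14 \<alpha>) \<longleftrightarrow> \<alpha> \<in> K"
| "listed K W (C15 \<alpha>) \<longleftrightarrow> \<alpha> \<in> K"
| "listed K W _ \<longleftrightarrow> True"

text \<open>
  A further conservative algebra, isomorphic to none of the above, see \<open>alg_omitted_conservative\<close>
  and \<open>alg_omitted_not_listed\<close> below.
\<close>

definition alg_omitted :: "'k::field ^ 2 \<Rightarrow> 'k ^ 2 \<Rightarrow> 'k ^ 2" where
  "alg_omitted = mult_table e1 e2 e1 0"

section \<open>Existence of the sets of representatives\<close>

lemma orbit_reps_exist:
  assumes eq: "\<And>x y. y \<in> orb x \<Longrightarrow> orb y = orb x"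
    and pick: "\<And>x. x \<in> X \<Longrightarrow> \<exists>y\<in>X \<inter> orb x. Q y"
  shows "\<exists>R. orbit_reps X orb R \<and> (\<forall>r\<in>R. Q r)"
proof -
  define c where "c S = (SOME y. y \<in> X \<inter> S \<and> Q y)" for S
  have c: "c (orb x) \<in> X \<and> c (orb x) \<in> orb x \<and> Q (c (orb x))" if "x \<in> X" for x
  proof -
    have "\<exists>y. y \<in> X \<inter> orb x \<and> Q y" using pick[OF that] by blast
    from someI_ex[OF this] show ?thesis by (simp add: c_def)
  qed
  define R where "R = (\<lambda>x. c (orb x)) ` X"
  have uniq: "\<exists>!r. r \<in> R \<and> r \<in> orb x" if x: "x \<in> X" for x
  proof (rule ex1I[of _ "c (orb x)"])
    show "c (orb x) \<in> R \<and> c (orb x) \<in> orb x" using c[OF x] x by (auto simp: R_def)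
  next
    fix r assume r: "r \<in> R \<and> r \<in> orb x"
    then obtain y where y: "y \<in> X" "r = c (orb y)" by (auto simp: R_def)
    then have "orb r = orb y" using c[OF y(1)] eq[of r y] by simp
    moreover have "orb r = orb x" using r eq[of r x] by simp
    ultimately show "r = c (orb x)" using y by simp
  qed
  have "R \<subseteq> X" using c by (simp add: R_def image_subset_iff)
  then have "orbit_reps X orb R" unfolding orbit_reps_def by (intro conjI ballI uniq)
  moreover have "\<forall>r\<in>R. Q r" using c by (simp add: R_def)
  ultimately show ?thesis by (intro exI conjI)
qed

lemma inversion_reps_exist: "\<exists>K :: 'k::field set. inversion_reps K"
proof -
  have "\<exists>K. orbit_reps (UNIV - {0, 1 :: 'k}) (\<lambda>a. {a, inverse a}) K \<and> (\<forall>r\<in>K. True)"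
  proof (rule orbit_reps_exist)
    show "{y, inverse y} = {x, inverse x}" if "y \<in> {x, inverse x}" for x y :: 'k
      using that by (elim insertE emptyE) (simp_all add: insert_commute)
  qed blast+
  then obtain K where "orbit_reps (UNIV - {0, 1 :: 'k}) (\<lambda>a. {a, inverse a}) K" by (elim exE conjE)
  then show ?thesis by (auto simp only: inversion_reps_def)
qed

lemma orb3_eq: "t \<in> orb3 u \<Longrightarrow> orb3 t = orb3 u"
proof (cases u)
  case (fields a b c)
  assume "t \<in> orb3 u"
  then consider "t = (a, b, c)" | "t = (a, c, b)" | "t = (b, a, c)" | "t = (b, c, a)"
    | "t = (c, a, b)" | "t = (c, b, a)"
    unfolding fields orb3.simps by blast
  then show ?thesis unfolding fields by cases (simp_all only: orb3.simps, blast+)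
qed

lemma triple_swap12:
  assumes "\<Gamma> \<in> generic_params" "triple_of \<Gamma> = (a, b, c)"
  shows "(b, a, c) \<in> triple_of ` generic_params"
proof -
  obtain \<alpha> \<beta> \<gamma> \<delta> where G: "\<Gamma> = (\<alpha>, \<beta>, \<gamma>, \<delta>)" by (metis prod_cases4)
  have "(\<delta>, \<gamma>, \<beta>, \<alpha>) \<in> generic_params" "triple_of (\<delta>, \<gamma>, \<beta>, \<alpha>) = (b, a, c)"
    using assms by (auto simp: G generic_params_def triple_of_def calT_def algebra_simps)
  then show ?thesis by force
qed

lemma triple_swap23:
  fixes \<Gamma> :: "'k::field \<times> 'k \<times> 'k \<times> 'k"
  assumes "\<Gamma> \<in> generic_params" "triple_of \<Gamma> = (a, b, c)"
  shows "(a, c, b) \<in> triple_of ` generic_params"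
proof -
  obtain \<alpha> \<beta> \<gamma> \<delta> where G: "\<Gamma> = (\<alpha>, \<beta>, \<gamma>, \<delta>)" by (metis prod_cases4)
  define D where "D = (\<alpha> + \<gamma>) * (\<beta> + \<delta>) - 1"
  define p where "p = (\<beta> * \<gamma> - (\<alpha> - 1) * (\<delta> - 1)) / D"
  define q where "q = (\<alpha> * \<delta> - (\<beta> - 1) * (\<gamma> - 1)) / D"
  have D: "D \<noteq> 0" and s: "\<beta> + \<delta> \<noteq> 1" and r: "\<gamma> + \<alpha> \<noteq> 1"
    using assms by (auto simp: G generic_params_def calT_def D_def)
  have abc: "a = (\<beta>, \<delta>)" "b = (\<gamma>, \<alpha>)" "c = (p, q)"
    using assms(2) by (auto simp: G triple_of_def p_def q_def D_def)
  have pD: "p * D = \<beta> * \<gamma> - (\<alpha> - 1) * (\<delta> - 1)" and qD: "q * D = \<alpha> * \<delta> - (\<beta> - 1) * (\<gamma> - 1)"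
    using D by (auto simp: p_def q_def)
  have "(p + q - 1) * D = p * D + q * D - D" by (simp add: algebra_simps)
  also have "\<dots> = - (\<gamma> + \<alpha> - 1) * (\<beta> + \<delta> - 1)"
    unfolding pD qD by (simp add: D_def algebra_simps)
  finally have pq: "(p + q - 1) * D = - (\<gamma> + \<alpha> - 1) * (\<beta> + \<delta> - 1)" .
  have pq1: "p + q \<noteq> 1" using pq r s D by auto
  have "((q + p) * (\<beta> + \<delta>) - 1) * D = (q * D + p * D) * (\<beta> + \<delta>) - D"
    by (simp add: algebra_simps)
  also have "\<dots> = (\<beta> + \<delta> - 1) * (\<beta> + \<delta> - 1)"
    unfolding pD qD by (simp add: D_def algebra_simps)
  finally have D': "((q + p) * (\<beta> + \<delta>) - 1) * D = (\<beta> + \<delta> - 1) * (\<beta> + \<delta> - 1)" .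
  define E where "E = (q + p) * (\<beta> + \<delta>) - 1"
  have E: "E \<noteq> 0" using D' s by (auto simp: E_def)
  have ED: "E * D = (\<beta> + \<delta> - 1) * (\<beta> + \<delta> - 1)" using D' by (simp add: E_def)
  have "(\<beta> * p - (q - 1) * (\<delta> - 1)) * D = \<beta> * (p * D) - (q * D - D) * (\<delta> - 1)"
    by (simp add: algebra_simps)
  also have "\<dots> = \<gamma> * (E * D)"
    unfolding pD qD ED by (simp add: D_def algebra_simps)
  finally have g: "(\<beta> * p - (q - 1) * (\<delta> - 1)) / E = \<gamma>" using D E by simp
  have "(q * \<delta> - (\<beta> - 1) * (p - 1)) * D = q * D * \<delta> - (\<beta> - 1) * (p * D - D)"
    by (simp add: algebra_simps)
  also have "\<dots> = \<alpha> * (E * D)"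
    unfolding pD qD ED by (simp add: D_def algebra_simps)
  finally have al: "(q * \<delta> - (\<beta> - 1) * (p - 1)) / E = \<alpha>" using D E by simp
  have "(q, \<beta>, p, \<delta>) \<in> generic_params"
    using E pq1 s by (auto simp: generic_params_def calT_def E_def)
  moreover have "triple_of (q, \<beta>, p, \<delta>) = (a, c, b)"
    using g al by (simp add: triple_of_def abc E_def)
  ultimately show ?thesis by force
qed

lemma triple_closed:
  assumes "t \<in> triple_of ` generic_params" "u \<in> orb3 t"
  shows "u \<in> triple_of ` (generic_params :: ('k::field \<times> 'k \<times> 'k \<times> 'k) set)"
proof -
  let ?X = "triple_of ` (generic_params :: ('k \<times> 'k \<times> 'k \<times> 'k) set)"
  have s12: "(b, a, c) \<in> ?X" if "(a, b, c) \<in> ?X" for a b c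
    using that triple_swap12 by (metis imageE)
  have s23: "(a, c, b) \<in> ?X" if "(a, b, c) \<in> ?X" for a b c
    using that triple_swap23 by (metis imageE)
  obtain a b c where t: "t = (a, b, c)" by (cases t)
  have 1: "(a, b, c) \<in> ?X" using assms(1) t by simp
  note 2 = s12[OF 1] and 3 = s23[OF 1]
  note 4 = s23[OF 2] and 5 = s12[OF 3]
  note 6 = s12[OF 4]
  show ?thesis using assms(2) 1 2 3 4 5 6 unfolding t orb3.simps by blast
qed

lemma adapted_triple_reps_exist: "\<exists>W :: 'k::field triple set. triple_reps W \<and> adapted_reps W"
proof -
  let ?X = "triple_of ` (generic_params :: ('k \<times> 'k \<times> 'k \<times> 'k) set)"
  define good :: "'k triple \<Rightarrow> bool" where
    "good t \<longleftrightarrow> (\<exists>a b. (0, a, b, 0) \<in> generic_params \<and> t = triple_of (0, a, b, 0))" for t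
  define Q :: "'k triple \<Rightarrow> bool" where
    "Q t \<longleftrightarrow> (case t of (c1, c2, c3) \<Rightarrow> c1 \<noteq> c2 \<longrightarrow> c3 \<noteq> c1 \<and> c3 \<noteq> c2) \<and>
       ((\<exists>u\<in>orb3 t. good u) \<longrightarrow> good t)" for t
  have third: "triple_of (0, a, b, 0) = ((a, 0), (b, 0), (1, x)) \<Longrightarrow> x \<noteq> 0"
    if "(0, a, b, 0) \<in> generic_params" for a b x :: 'k
    using that by (auto simp: triple_of_def generic_params_def calT_def)
  have form: "\<exists>a b x. t = ((a, 0), (b, 0), (1, x)) \<and> x \<noteq> 0" if "good t" for t
  proof -
    from that obtain a b where ab: "(0, a, b, 0) \<in> generic_params" "t = triple_of (0, a, b, 0)"
      by (auto simp: good_def)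
    define x where "x = snd (calC3 (0, a, b, 0))"
    have t: "t = ((a, 0), (b, 0), (1, x))"
      using ab by (auto simp: x_def triple_of_def generic_params_def mult.commute)
    moreover have "x \<noteq> 0" using third[OF ab(1), of x] ab(2) t by simp
    ultimately show ?thesis by (intro exI conjI)
  qed
  have "\<exists>y\<in>?X \<inter> orb3 t. Q y" if t: "t \<in> ?X" for t
  proof (cases "\<exists>u\<in>orb3 t. good u")
    case True
    then obtain u where u: "u \<in> orb3 t" "good u" by blast
    obtain a b x where "u = ((a, 0), (b, 0), (1, x))" "x \<noteq> 0" using form[OF u(2)] by blast
    then have "Q u" using u(2) by (auto simp: Q_def)
    then show ?thesis using u(1) triple_closed[OF t u(1)] by blast
  next
    case False
    obtain a b c where abc: "t = (a, b, c)" by (cases t)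
    have "\<exists>y\<in>orb3 t. (case y of (c1, c2, c3) \<Rightarrow> c1 \<noteq> c2 \<longrightarrow> c3 \<noteq> c1 \<and> c3 \<noteq> c2)"
      unfolding abc by (cases "a = b"; cases "a = c"; cases "b = c") auto
    then obtain y where y: "y \<in> orb3 t"
      "case y of (c1, c2, c3) \<Rightarrow> c1 \<noteq> c2 \<longrightarrow> c3 \<noteq> c1 \<and> c3 \<noteq> c2" by blast
    then have "Q y" using False orb3_eq[OF y(1)] by (auto simp: Q_def)
    then show ?thesis using y(1) triple_closed[OF t y(1)] by blast
  qed
  then have "\<exists>W. orbit_reps ?X orb3 W \<and> (\<forall>r\<in>W. Q r)"
    by (intro orbit_reps_exist orb3_eq)
  then obtain W where W: "orbit_reps ?X orb3 W" "\<forall>r\<in>W. Q r" by (elim exE conjE)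
  have "triple_reps W" using W by (auto simp: triple_reps_def Q_def)
  moreover have "(0, a, b, 0) \<in> calV W \<or> (0, b, a, 0) \<in> calV W"
    if g: "(0, a, b, 0) \<in> generic_params" for a b
  proof -
    let ?t = "triple_of (0, a, b, 0)"
    obtain r where r: "r \<in> W" "r \<in> orb3 ?t" using W(1) g unfolding orbit_reps_def by blast
    have "?t \<in> orb3 r" using orb3_eq[OF r(2)] by (cases ?t) auto
    moreover have "good ?t" using g by (auto simp: good_def)
    ultimately have "good r" using W(2) r(1) by (auto simp: Q_def)
    then obtain a' b' where r': "(0, a', b', 0) \<in> generic_params" "r = triple_of (0, a', b', 0)"
      by (auto simp: good_def)
    then have "(0, a', b', 0) \<in> calV W" using r(1) by (auto simp: calV_def generic_params_def)
    moreover have "(a' = a \<and> b' = b) \<or> (a' = b \<and> b' = a)"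
    proof -
      obtain x where x: "?t = ((a, 0), (b, 0), (1, x))" "x \<noteq> 0"
        using form[OF \<open>good ?t\<close>] by (auto simp: triple_of_def)
      obtain x' where x': "r = ((a', 0), (b', 0), (1, x'))" "x' \<noteq> 0"
        using form[OF \<open>good r\<close>] by (auto simp: r'(2) triple_of_def)
      show ?thesis using r(2) x x' by auto
    qed
    ultimately show ?thesis by auto
  qed
  ultimately show ?thesis by (auto simp: adapted_reps_def)
qed

section \<open>The omitted algebra\<close>

lemma mult_table_component:
  "mult_table p q r t x y $ i =
     x $ 1 * y $ 1 * p $ i + x $ 1 * y $ 2 * q $ i + x $ 2 * y $ 1 * r $ i + x $ 2 * y $ 2 * t $ i"
  by (simp add: mult_table_def)

lemma bilinear_mult_table: "bilinear_mult (*s) (mult_table p q r t)"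
proof -
  let ?B = "mult_table p q r t"
  have "?B x (y + z) = ?B x y + ?B x z" "?B (y + z) x = ?B y x + ?B z x"
    "?B x (c *s y) = c *s ?B x y" "?B (c *s y) x = c *s ?B y x" for x y z c
    unfolding vec_eq_iff
    by (simp_all only: mult_table_component vector_add_component vector_smult_component
        ring_distribs ac_simps HOL.simp_thms)
  then show ?thesis
    unfolding bilinear_mult_def Vector_Spaces.linear_iff using vec.vector_space_axioms by blast
qed

lemma e_nth: "(e1 :: 'k::field^2) $ 1 = 1" "(e1 :: 'k::field^2) $ 2 = 0"
  "(e2 :: 'k::field^2) $ 1 = 0" "(e2 :: 'k::field^2) $ 2 = 1"
  by (simp_all add: axis_def)

lemma alg_omitted_conservative:
  "algebra_on (*s) (alg_omitted :: 'k::field ^ 2 \<Rightarrow> _)"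
  "conservative (*s) (alg_omitted :: 'k::field ^ 2 \<Rightarrow> _)"
proof -
  show "algebra_on (*s) (alg_omitted :: 'k::field ^ 2 \<Rightarrow> _)"
    unfolding algebra_on_def alg_omitted_def
    by (intro conjI bilinear_mult_table vec.vector_space_axioms)
  let ?F = "mult_table e1 e2 e2 e2 :: 'k ^ 2 \<Rightarrow> _"
  show "conservative (*s) (alg_omitted :: 'k::field ^ 2 \<Rightarrow> _)"
    unfolding conservative_def
    by (intro exI[of _ ?F] conjI bilinear_mult_table allI ext)
      (simp add: vec_eq_iff forall_2 alg_omitted_def bracket_def left_mult_def
        mult_table_component e_nth algebra_simps)
qed

lemma omitted_idempotent:
  fixes x :: "'k::field ^ 2"
  assumes "alg_omitted x x = x" "x \<noteq> 0" shows "x = e1"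
proof -
  have 1: "x $ 1 * x $ 1 + x $ 2 * x $ 1 = x $ 1" and 2: "x $ 1 * x $ 2 = x $ 2"
    using assms(1) by (simp_all add: vec_eq_iff forall_2 alg_omitted_def mult_table_component e_nth)
  have 3: "x $ 2 = 0"
  proof (rule ccontr)
    assume "x $ 2 \<noteq> 0"
    with 1 2 show False by simp
  qed
  then have "x $ 1 \<noteq> 0" using assms(2) by (simp add: vec_eq_iff forall_2)
  then show ?thesis using 1 3 by (simp add: vec_eq_iff forall_2 e_nth)
qed

lemma omitted_nil:
  fixes x :: "'k::field ^ 2"
  assumes "alg_omitted x x = 0" shows "x $ 1 = 0"
  using assms by (auto simp: vec_eq_iff forall_2 alg_omitted_def mult_table_component e_nth)

lemma alg_omitted_not_listed:
  "\<not> algebra_iso (*s) (alg_omitted :: 'k::field ^ 2 \<Rightarrow> _) (*s) (calg l)"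
proof
  assume "algebra_iso (*s) (alg_omitted :: 'k ^ 2 \<Rightarrow> _) (*s) (calg l)"
  then obtain f :: "'k ^ 2 \<Rightarrow> 'k ^ 2" where lin: "Vector_Spaces.linear (*s) (*s) f" and bij: "bij f"
    and hom: "\<And>x y. f (alg_omitted x y) = calg l (f x) (f y)"
    unfolding algebra_iso_def by blast
  interpret f: Vector_Spaces.linear "(*s)" "(*s)" f by (fact lin)
  have inj: "f x = f y \<longleftrightarrow> x = y" for x y
    using bij_is_inj[OF bij] by (rule inj_eq)
  have f0: "f x = 0 \<longleftrightarrow> x = 0" for x using inj[of x 0] f.zero by simp
  have surj: "\<exists>x. f x = y" for y using bij_is_surj[OF bij] by (metis surjD)
  have idem: "y = f e1" if "calg l y y = y" "y \<noteq> 0" for y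
  proof -
    obtain x where x: "f x = y" using surj by blast
    then have "f (alg_omitted x x) = f x" "f x \<noteq> 0" using that hom[of x x] by simp_all
    then have "x = e1" using omitted_idempotent[of x] inj f0 by blast
    then show ?thesis using x by simp
  qed
  have nil: "\<exists>c. y = c *s f e2" if "calg l y y = 0" for y
  proof -
    obtain x where x: "f x = y" using surj by blast
    then have "f (alg_omitted x x) = 0" using that hom[of x x] by simp
    then have "x $ 1 = 0" using omitted_nil f0 by blast
    then have "x = x $ 2 *s e2" by (simp add: vec_eq_iff forall_2 e_nth)
    then have "y = x $ 2 *s f e2" using x f.scale[of "x $ 2" e2] by argo
    then show ?thesis by blast
  qed
  have ee: "(e1 :: 'k ^ 2) \<noteq> e2" "(e1 :: 'k ^ 2) \<noteq> 0" "(e2 :: 'k ^ 2) \<noteq> 0"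
    by (auto simp: vec_eq_iff forall_2 e_nth)
  have two_idem: False if "calg l e1 e1 = e1" "calg l e2 e2 = e2"
    using idem[OF that(1)] idem[OF that(2)] ee by simp
  have two_nil: False if "calg l y y = 0" "calg l z z = 0" "y $ 1 * z $ 2 \<noteq> y $ 2 * z $ 1" for y z
    using nil[OF that(1)] nil[OF that(2)] that(3) by (auto simp: algebra_simps)
  define u where "u = f e1"
  define v where "v = f e2"
  have u0: "u \<noteq> 0" and v0: "v \<noteq> 0" using ee f0 by (auto simp: u_def v_def)
  have "alg_omitted e1 e1 = (e1 :: 'k ^ 2)" "alg_omitted e2 e1 = (e1 :: 'k ^ 2)" "alg_omitted e2 e2 = (0 :: 'k ^ 2)"
    by (auto simp: vec_eq_iff forall_2 alg_omitted_def mult_table_component e_nth)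
  then have uu: "calg l u u = u" and vu: "calg l v u = u" and vv: "calg l v v = 0"
    using hom f.zero by (metis u_def v_def)+
  note S = vec_eq_iff forall_2 mult_table_component e_nth
  show False
  proof (cases l)
    case C01 then show ?thesis using uu u0 by (auto simp: S)
  next
    case C02 then show ?thesis using uu u0 by (auto simp: S algebra_simps)
  next
    case C03 then show ?thesis using uu u0 by (auto simp: S)
  next
    case C04 then show ?thesis using uu u0 by (auto simp: S)
  next
    case (C05 a) then show ?thesis by (intro two_nil[of e1 e2]) (auto simp: S)
  next
    case C06 then show ?thesis by (intro two_nil[of e1 e2]) (auto simp: S)
  next
    case C07 then show ?thesis using vv v0 by (auto simp: S)
  next
    case C08 then show ?thesis by (intro two_nil[of "e1 - e2" e2]) (auto simp: S)
  next
    case C09 then show ?thesis by (intro two_nil[of "e1 - e2" e2]) (auto simp: S)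
  next
    case (C10 a b) then show ?thesis using uu vu vv u0 by (auto simp: S)
  next
    case (C11 a b) then show ?thesis by (intro two_idem) (simp_all add: S)
  next
    case (C12 a) then show ?thesis by (intro two_idem) (simp_all add: S)
  next
    case (C13 a) then show ?thesis by (intro two_idem) (simp_all add: S)
  next
    case (C14 a) then show ?thesis by (intro two_idem) (simp_all add: S)
  next
    case (C15 a) then show ?thesis by (intro two_idem) (simp_all add: S)
  next
    case C16 then show ?thesis by (intro two_idem) (simp_all add: S)
  next
    case (C17 a) then show ?thesis by (intro two_idem) (simp_all add: S)
  qed
qed

end

theory Submission
  imports Defs
begin

text \<open>
  Conservativity of \<open>P\<close> means that the span of \<open>[L\<^sub>1, P]\<close> and \<open>[L\<^sub>2, P]\<close> is stable under the operators
  \<open>[L\<^sub>b, _]\<close>, which in coordinates is a system of polynomial equations in the structure constants.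
  The cubic form \<open>x \<and> x\<^sup>2\<close> has a zero over an algebraically closed field, so \<open>P\<close> has a
  nonzero idempotent or a nonzero element of square zero.  If there are two idempotents, they form
  a basis; if there is only one, or none, a change of basis brings \<open>P\<close> into a normal form in which all
  but a few structure constants vanish.  In each normal form the polynomial system is solved
  explicitly, and a rescaling of the basis leads to the list.

  Conversely, the listed algebras are told apart by the eigenvalues of left and right multiplication
  by an idempotent \<open>x\<close> on the quotient by the line of \<open>x\<close>, and by coarse properties of the idempotents
  and the elements of square zero.
\<close>

text \<open>The coefficients \<open>f\<close> and \<open>g\<close> in \<open>bracket_dep\<close> are
  unknowns that have to be eliminated. If \<open>e1\<close> is idempotent, then
  \<open>[L_1, P](e1, e1) = - e1\<close> and \<open>[L_1, [L_1, P]](e1, e1) = e1\<close>, so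
  \<open>g = 0\<close> forces \<open>f = -1\<close>; this is the origin of the recurring
  \<open>f = -1\<close>. The pair \<open>(e1, e1)\<close> then amounts to
  \<open>[L_1, [L_1, P]] = - [L_1, P]\<close>. Some families satisfy this equation without being
  conservative, and only the other pairs of basis vectors exclude them. Once a basis vector spans a
  zero line of the cubic form, the remaining quadratic factor provides a second zero line unless the
  first one is a triple zero. This is why each reduction below has one exceptional normal form
  beside the general one.\<close>

definition vec2 :: "'k \<Rightarrow> 'k \<Rightarrow> 'k ^ 2" where
  "vec2 a b = (\<chi> i. if i = 1 then a else b)"

lemma vec2_nth [simp]: "vec2 a b $ 1 = a" "vec2 a b $ 2 = b"
  by (simp_all add: vec2_def)

lemma vec2_eq_iff: "x = y \<longleftrightarrow> x $ 1 = y $ 1 \<and> x $ 2 = (y :: 'k ^ 2) $ 2"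
  by (simp add: vec_eq_iff forall_2)

text \<open>The arguments are the coordinates of \<open>e\<^sub>1e\<^sub>1\<close>, \<open>e\<^sub>1e\<^sub>2\<close>, \<open>e\<^sub>2e\<^sub>1\<close>, \<open>e\<^sub>2e\<^sub>2\<close>, in this order.\<close>

definition tab :: "'k::field \<Rightarrow> 'k \<Rightarrow> 'k \<Rightarrow> 'k \<Rightarrow> 'k \<Rightarrow> 'k \<Rightarrow> 'k \<Rightarrow> 'k \<Rightarrow> 'k ^ 2 \<Rightarrow> 'k ^ 2 \<Rightarrow> 'k ^ 2"
  where "tab a1 a2 b1 b2 c1 c2 d1 d2 = mult_table (vec2 a1 a2) (vec2 b1 b2) (vec2 c1 c2) (vec2 d1 d2)"

lemma tab_nth:
  "tab a1 a2 b1 b2 c1 c2 d1 d2 x y $ 1 = x$1 * y$1 * a1 + x$1 * y$2 * b1 + x$2 * y$1 * c1 + x$2 * y$2 * d1"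
  "tab a1 a2 b1 b2 c1 c2 d1 d2 x y $ 2 = x$1 * y$1 * a2 + x$1 * y$2 * b2 + x$2 * y$1 * c2 + x$2 * y$2 * d2"
  by (simp_all add: tab_def mult_table_component)

lemma tab_eq_iff:
  "tab a1 a2 b1 b2 c1 c2 d1 d2 = tab a1' a2' b1' b2' c1' c2' d1' d2' \<longleftrightarrow>
   a1 = a1' \<and> a2 = a2' \<and> b1 = b1' \<and> b2 = b2' \<and> c1 = c1' \<and> c2 = c2' \<and> d1 = d1' \<and> d2 = d2'"
  (is "?P = ?Q \<longleftrightarrow> _")
proof
  assume "?P = ?Q"
  then have "?P x y = ?Q x y" for x y by simp
  from this[of e1 e1] this[of e1 e2] this[of e2 e1] this[of e2 e2]
  show "a1 = a1' \<and> a2 = a2' \<and> b1 = b1' \<and> b2 = b2' \<and> c1 = c1' \<and> c2 = c2' \<and> d1 = d1' \<and> d2 = d2'"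
    by (simp add: vec2_eq_iff tab_nth e_nth)
qed simp

lemma calg_tab:
  "calg C01 = tab 1 1 0 1 0 0 0 0"
  "calg C02 = tab 1 1 0 2 0 (-1) 0 0"
  "calg C03 = tab 0 1 0 1 0 (-1) 0 0"
  "calg C04 = tab 0 1 0 0 0 0 0 0"
  "calg (C05 \<alpha>) = tab 0 0 (1 - \<alpha>) 0 \<alpha> 0 0 0"
  "calg C06 = tab 0 0 0 1 0 (-1) 0 0"
  "calg C07 = tab 0 1 0 0 1 0 0 1"
  "calg C08 = tab 1 0 1 0 0 0 0 0"
  "calg C09 = tab 1 0 0 1 1 (-1) 0 0"
  "calg (C10 \<alpha> \<beta>) = tab 1 0 0 \<alpha> 0 \<beta> 0 0"
  "calg (C11 \<alpha> \<beta>) = tab 1 0 0 \<alpha> \<beta> 0 0 1"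
  "calg (C12 \<alpha>) = tab 1 0 0 1 1 \<alpha> 0 1"
  "calg (C13 \<alpha>) = tab 1 0 0 \<alpha> 1 0 0 1"
  "calg (C14 \<alpha>) = tab 1 0 0 1 \<alpha> ((1 - \<alpha>) / \<alpha>) 0 1"
  "calg (C15 \<alpha>) = tab 1 0 (\<alpha> - 1) (1 / \<alpha>) 1 0 0 1"
  "calg C16 = tab 1 0 (-1) 0 0 (-1) 0 1"
  "calg (C17 \<alpha>) = tab 1 0 (1 - \<alpha>) \<alpha> \<alpha> (1 - \<alpha>) 0 1"
  "alg_omitted = tab 1 0 0 1 1 0 0 0"
  by (simp_all add: fun_eq_iff vec2_eq_iff tab_nth mult_table_component e_nth alg_omitted_def)

section \<open>Brackets of multiplication tables in coordinates\<close>

lemma bilinear_tab: "bilinear_mult (*s) (tab a1 a2 b1 b2 c1 c2 d1 d2)"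
  unfolding tab_def by (rule bilinear_mult_table)

text \<open>\<open>(p, q)\<close> and \<open>(r, s)\<close> are the images of \<open>e1\<close> and
  \<open>e2\<close> under the left multiplication in question; the primed entries belong to the
  other basis vector. Hence both brackets obey the same formula. The second table is arbitrary, so
  the rules apply again to their own right-hand sides.\<close>

lemma bracket_tab:
  "bracket (left_mult (tab p q r s p' q' r' s') e1) (tab a1 a2 b1 b2 c1 c2 d1 d2) =
   tab (r*a2 - q*c1 - p*a1 - q*b1) (q*a1 + s*a2 - p*a2 - q*c2 - p*a2 - q*b2)
       (r*b2 - q*d1 - r*a1 - s*b1) (q*b1 - p*b2 - q*d2 - r*a2)
       (r*c2 - r*a1 - s*c1 - q*d1) (q*c1 - r*a2 - p*c2 - q*d2)
       (p*d1 + r*d2 - r*b1 - s*d1 - r*c1 - s*d1) (q*d1 - r*b2 - r*c2 - s*d2)"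
  "bracket (left_mult (tab p' q' r' s' p q r s) e2) (tab a1 a2 b1 b2 c1 c2 d1 d2) =
   tab (r*a2 - q*c1 - p*a1 - q*b1) (q*a1 + s*a2 - p*a2 - q*c2 - p*a2 - q*b2)
       (r*b2 - q*d1 - r*a1 - s*b1) (q*b1 - p*b2 - q*d2 - r*a2)
       (r*c2 - r*a1 - s*c1 - q*d1) (q*c1 - r*a2 - p*c2 - q*d2)
       (p*d1 + r*d2 - r*b1 - s*d1 - r*c1 - s*d1) (q*d1 - r*b2 - r*c2 - s*d2)"
  by (simp_all add: fun_eq_iff vec2_eq_iff tab_nth bracket_def left_mult_def e_nth ring_distribs ac_simps)

lemma bracket_tab_linear:
  fixes P :: "'k::field ^ 2 \<Rightarrow> 'k ^ 2 \<Rightarrow> 'k ^ 2"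
  assumes "P = tab p1 p2 q1 q2 r1 r2 t1 t2"
  shows "bracket (left_mult P w) P x y =
    w$1 *s bracket (left_mult P e1) P x y + w$2 *s bracket (left_mult P e2) P x y"
  unfolding assms bracket_tab
  by (simp add: vec2_eq_iff tab_nth bracket_def left_mult_def e_nth algebra_simps)

lemma tab_linear_combination:
  "a *s tab a1 a2 b1 b2 c1 c2 d1 d2 x y + b *s tab a1' a2' b1' b2' c1' c2' d1' d2' x y =
   tab (a*a1 + b*a1') (a*a2 + b*a2') (a*b1 + b*b1') (a*b2 + b*b2')
       (a*c1 + b*c1') (a*c2 + b*c2') (a*d1 + b*d1') (a*d2 + b*d2') x y"
  by (simp add: vec2_eq_iff tab_nth algebra_simps)

text \<open>
  Conservativity says that the span of \<open>[L\<^sub>1, P]\<close> and \<open>[L\<^sub>2, P]\<close> is invariant under all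
  \<open>[L\<^sub>b, _]\<close>; \<open>f\<close> and \<open>g\<close> are, up to sign, the coordinates of the paper's \<open>F(a, b)\<close>.
\<close>

definition bracket_dep :: "('k::field ^ 2 \<Rightarrow> 'k ^ 2 \<Rightarrow> 'k ^ 2) \<Rightarrow> 'k ^ 2 \<Rightarrow> 'k ^ 2 \<Rightarrow> 'k \<Rightarrow> 'k \<Rightarrow> bool" where
  "bracket_dep P a b f g \<longleftrightarrow> bracket (left_mult P b) (bracket (left_mult P a) P) =
    (\<lambda>x y. f *s bracket (left_mult P e1) P x y + g *s bracket (left_mult P e2) P x y)"

lemma conservative_bracket_dep:
  assumes "conservative (*s) (tab p1 p2 q1 q2 r1 r2 t1 t2)"
  shows "\<exists>f g. bracket_dep (tab p1 p2 q1 q2 r1 r2 t1 t2) a b f g"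
proof -
  let ?P = "tab p1 p2 q1 q2 r1 r2 t1 t2"
  obtain F where F: "bracket (left_mult ?P b) (bracket (left_mult ?P a) ?P) =
      (\<lambda>x y. - bracket (left_mult ?P (F a b)) ?P x y)"
    using assms unfolding conservative_def by blast
  show ?thesis
    unfolding bracket_dep_def F bracket_tab_linear[OF refl, of _ _ _ _ _ _ _ _ "F a b"]
    by (rule exI[of _ "- (F a b $ 1)"], rule exI[of _ "- (F a b $ 2)"]) (simp add: fun_eq_iff)
qed

lemmas bracket_dep_simps = bracket_dep_def bracket_tab tab_linear_combination tab_eq_iff

section \<open>Isomorphisms\<close>

lemma algebra_iso_sym:
  assumes "algebra_iso s P t Q"
  shows "algebra_iso t Q s P"
proof -
  obtain f where f: "Vector_Spaces.linear s t f" "bij f" "\<And>x y. f (P x y) = Q (f x) (f y)"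
    using assms unfolding algebra_iso_def by blast
  let ?g = "inv f"
  have g: "?g (f x) = x" "f (?g y) = y" for x y
    using f(2) by (simp_all add: bij_is_inj bij_is_surj surj_f_inv_f)
  have i: "?g y = x \<longleftrightarrow> y = f x" for x y using g by metis
  have "Vector_Spaces.linear t s ?g" "?g (Q x y) = P (?g x) (?g y)" for x y
    using f(1,3) unfolding Vector_Spaces.linear_iff i by (simp_all add: g)
  then show ?thesis
    unfolding algebra_iso_def using bij_imp_bij_inv[OF f(2)] by blast
qed

lemma algebra_iso_trans:
  assumes "algebra_iso s P t Q" "algebra_iso t Q r R"
  shows "algebra_iso s P r R"
proof -
  obtain f where f: "Vector_Spaces.linear s t f" "bij f" "\<And>x y. f (P x y) = Q (f x) (f y)"
    using assms(1) unfolding algebra_iso_def by blast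
  obtain g where g: "Vector_Spaces.linear t r g" "bij g" "\<And>x y. g (Q x y) = R (g x) (g y)"
    using assms(2) unfolding algebra_iso_def by blast
  have "Vector_Spaces.linear s r (g \<circ> f)" using f(1) g(1) unfolding Vector_Spaces.linear_iff by simp
  then show ?thesis
    unfolding algebra_iso_def using bij_comp[OF f(2) g(2)] f(3) g(3) by (metis comp_apply)
qed

lemma conservative_iso:
  assumes "algebra_iso s P t Q" "conservative s P"
  shows "conservative t Q"
proof -
  obtain f where f: "Vector_Spaces.linear s t f" "bij f" "\<And>x y. f (P x y) = Q (f x) (f y)"
    using assms(1) unfolding algebra_iso_def by blast
  obtain g where g: "Vector_Spaces.linear t s g" "\<And>x. g (f x) = x" "\<And>y. f (g y) = y"
  proof -
    let ?g = "inv f"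
    have g: "?g (f x) = x" "f (?g y) = y" for x y
      using f(2) by (simp_all add: bij_is_inj bij_is_surj surj_f_inv_f)
    have i: "?g y = x \<longleftrightarrow> y = f x" for x y using g by metis
    have "Vector_Spaces.linear t s ?g"
      using f(1,3) unfolding Vector_Spaces.linear_iff i by (simp_all add: g)
    then show thesis using g that by blast
  qed
  obtain F where F: "bilinear_mult s F" "\<And>a b. bracket (left_mult P b) (bracket (left_mult P a) P) =
      (\<lambda>x y. - bracket (left_mult P (F a b)) P x y)"
    using assms(2) unfolding conservative_def by blast
  interpret f: Vector_Spaces.linear s t f by (fact f(1))
  define G where "G a b = f (F (g a) (g b))" for a b
  have Q: "Q x y = f (P (g x) (g y))" for x y using f(3) g(3) by simp
  \<comment> \<open>Stated for an arbitrary \<open>B\<close>, since it is needed twice: for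
    \<open>B = P\<close> and for \<open>B = [L_a, P]\<close>.\<close>
  have br: "bracket (left_mult Q a) (\<lambda>x y. f (B (g x) (g y))) =
      (\<lambda>x y. f (bracket (left_mult P (g a)) B (g x) (g y)))" for a B
    by (simp add: bracket_def left_mult_def Q g(2) f.diff fun_eq_iff)
  have QQ: "Q = (\<lambda>x y. f (P (g x) (g y)))" using Q by blast
  have "bilinear_mult t G"
    using f(1) g(1) F(1) unfolding bilinear_mult_def Vector_Spaces.linear_iff G_def by simp
  moreover have brQ: "bracket (left_mult Q a) Q = (\<lambda>x y. f (bracket (left_mult P (g a)) P (g x) (g y)))" for a
    using br[of a P] by (simp flip: QQ)
  moreover have "bracket (left_mult Q b) (bracket (left_mult Q a) Q) =
      (\<lambda>x y. - bracket (left_mult Q (G a b)) Q x y)" for a b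
    unfolding brQ br by (simp add: F(2) G_def g(2) f.neg)
  ultimately show ?thesis unfolding conservative_def by blast
qed

lemma algebra_iso_tab:
  assumes vs: "vector_space s" and bil: "bilinear_mult s P"
    and span: "\<And>x. \<exists>a b. x = s a u + s b v"
    and indep: "\<And>a b. s a u + s b v = 0 \<Longrightarrow> a = 0 \<and> b = 0"
    and tab: "P u u = s a1 u + s a2 v" "P u v = s b1 u + s b2 v"
      "P v u = s c1 u + s c2 v" "P v v = s d1 u + s d2 v"
  shows "algebra_iso s P (*s) (tab a1 a2 b1 b2 c1 c2 d1 d2)"
proof (rule algebra_iso_sym)
  interpret vector_space s by (fact vs)
  define f where "f x = s (x $ 1) u + s (x $ 2) v" for x :: "'a ^ 2"
  have lin: "Vector_Spaces.linear (*s) s f"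
    unfolding Vector_Spaces.linear_iff using vs vec.vector_space_axioms by (simp add: f_def algebra_simps)
  interpret f: Vector_Spaces.linear "(*s)" s f by (fact lin)
  have "inj f"
    unfolding f.inj_iff_eq_0 using indep by (auto simp: f_def vec2_eq_iff)
  moreover have "\<exists>y. x = f y" for x
    using span[of x] unfolding f_def by (metis vec2_nth)
  ultimately have "bij f" by (auto simp: bij_def surj_def)
  moreover have "f (tab a1 a2 b1 b2 c1 c2 d1 d2 x y) = P (f x) (f y)" for x y
  proof -
    have l: "P (a + b) c = P a c + P b c" "P a (b + c) = P a b + P a c"
      "P (s k a) b = s k (P a b)" "P a (s k b) = s k (P a b)" for a b c k
      using bil unfolding bilinear_mult_def Vector_Spaces.linear_iff by simp_all
    show ?thesis unfolding f_def l tab tab_nth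
      by (simp add: algebra_simps)
  qed
  ultimately show "algebra_iso (*s) (tab a1 a2 b1 b2 c1 c2 d1 d2) s P"
    unfolding algebra_iso_def using lin by blast
qed

text \<open>Cramer's rule. A nonzero determinant of \<open>u\<close> and \<open>v\<close> serves as
  the definition of a basis of the plane from here on.\<close>

lemma exists_comb:
  fixes u v :: "'k::field ^ 2"
  assumes "u$1 * v$2 \<noteq> u$2 * v$1"
  shows "\<exists>a b. x = a *s u + b *s v"
proof (intro exI)
  let ?D = "u $ 1 * v $ 2 - u $ 2 * v $ 1"
  have D: "?D \<noteq> 0" using assms by simp
  show "x = ((x$1 * v$2 - x$2 * v$1) / ?D) *s u + ((u$1 * x$2 - u$2 * x$1) / ?D) *s v"
    using D unfolding vec2_eq_iff
    by (simp add: divide_simps) (simp add: algebra_simps)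
qed

lemma algebra_iso_tab_basis:
  fixes P :: "'k::field ^ 2 \<Rightarrow> 'k ^ 2 \<Rightarrow> 'k ^ 2"
  assumes bil: "bilinear_mult (*s) P" and uv: "u $ 1 * v $ 2 \<noteq> u $ 2 * v $ 1"
    and tab: "P u u = a1 *s u + a2 *s v" "P u v = b1 *s u + b2 *s v"
      "P v u = c1 *s u + c2 *s v" "P v v = d1 *s u + d2 *s v"
  shows "algebra_iso (*s) P (*s) (tab a1 a2 b1 b2 c1 c2 d1 d2)"
proof (rule algebra_iso_tab[OF vec.vector_space_axioms bil _ _ tab])
  let ?D = "u $ 1 * v $ 2 - u $ 2 * v $ 1"
  have D: "?D \<noteq> 0" using uv by simp
  show "\<exists>a b. x = a *s u + b *s v" for x using exists_comb[OF uv] .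
  show "a = 0 \<and> b = 0" if "a *s u + b *s v = 0" for a b
  proof -
    from that have "a * u$1 + b * v$1 = 0" "a * u$2 + b * v$2 = 0"
      unfolding vec2_eq_iff by simp_all
    then have "a * ?D = 0" "b * ?D = 0" by algebra+
    with D show ?thesis by simp
  qed
qed

lemma exists_table:
  fixes s :: "'k::field \<Rightarrow> 'v::ab_group_add \<Rightarrow> 'v"
  assumes "algebra_on s P" "vector_space.dim s (UNIV :: 'v set) = 2"
  shows "\<exists>a1 a2 b1 b2 c1 c2 d1 d2. algebra_iso s P (*s) (tab a1 a2 b1 b2 c1 c2 d1 d2)"
proof -
  have vs: "vector_space s" and bil: "bilinear_mult s P" using assms(1) by (auto simp: algebra_on_def)
  interpret vector_space s by (fact vs)
  obtain B where B: "independent B" "UNIV \<subseteq> span B" "card B = 2"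
    using assms(2) basis_exists[of UNIV] by metis
  then obtain u v where uv: "B = {u, v}" "u \<noteq> v" by (meson card_2_iff)
  have span: "\<exists>a b. x = s a u + s b v" for x
  proof -
    have "x \<in> span {u, v}" using B uv by blast
    then obtain k where k: "x - s k u \<in> span {v}" using span_breakdown_eq[of x u "{v}"] by blast
    then obtain l where "x - s k u - s l v \<in> span {}" using span_breakdown_eq[of _ v "{}"] by blast
    then have "x = s k u + s l v" by (simp add: algebra_simps)
    then show ?thesis by blast
  qed
  have indep: "a = 0 \<and> b = 0" if "s a u + s b v = 0" for a b
  proof -
    have "v \<noteq> 0" using B(1) uv dependent_zero by blast
    have "u \<notin> span {v}" using B(1) uv independent_insert[of u "{v}"] by simp
    have "a = 0"
    proof (rule ccontr)
      assume a: "a \<noteq> 0"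
      have "s a u = s (- b) v" using that by (simp add: eq_neg_iff_add_eq_0)
      then have "u = s (inverse a) (s (- b) v)" using a by (metis scale_scale left_inverse scale_one)
      then have "u \<in> span {v}" by (simp add: span_base span_scale span_neg)
      with \<open>u \<notin> span {v}\<close> show False by blast
    qed
    then show ?thesis using that \<open>v \<noteq> 0\<close> by simp
  qed
  have "\<exists>a b. P x y = s a u + s b v" for x y using span by blast
  then show ?thesis using algebra_iso_tab[OF vs bil span indep] by metis
qed

section \<open>Algebras with two idempotents\<close>

lemma conservative_E_delta_0:
  fixes \<alpha> \<beta> \<gamma> :: "'k::field_char_0"
  assumes "conservative (*s) (tab 1 0 \<alpha> \<beta> \<gamma> 0 0 1)"
  shows "\<gamma> = 1 \<or> (\<alpha> = 0 \<and> (\<beta> * \<gamma> = 1 \<longrightarrow> \<beta> = 1))"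
proof -
  note D = conservative_bracket_dep[OF assms]
  have A: ?thesis if a: "\<alpha> = 0"
    using D[of e1 e1, unfolded bracket_dep_simps, simplified]
  proof (elim exE conjE, goal_cases)
    case (1 f g)
    have "\<beta> * \<gamma> = 1 \<Longrightarrow> \<beta> = 1" using 1 a by algebra
    then show ?thesis using a by simp
  qed
  have B: ?thesis if a: "\<alpha> \<noteq> 0" and c: "\<gamma> \<noteq> 1" and b: "\<not>(2*\<beta> = 1 \<and> \<alpha> = 1 \<and> \<gamma> = 2)"
    using D[of e1 e1, unfolded bracket_dep_simps, simplified]
  proof (elim exE conjE, goal_cases)
    case (1 f g)
    \<comment> \<open>The first coordinates at \<open>(e1, e1)\<close> and \<open>(e1, e2)\<close>
      read \<open>f + \<gamma> * g = -1\<close> and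
      \<open>\<alpha> * (f + g) = - \<alpha>\<close>.\<close>
    have "\<alpha> * g * (1 - \<gamma>) = 0" using 1(1,2) by algebra
    then have g: "g = 0" using a c by simp
    have f: "f = -1" using g 1 by algebra
    note 1 = 1[unfolded f g, simplified]
    have "\<alpha> * (2 + \<alpha>*\<beta> - 3*\<beta> - 2*\<gamma> + 3*\<beta>*\<gamma>) = 0"
      using 1 by algebra
    then have e7: "2 + \<alpha>*\<beta> - 3*\<beta> - 2*\<gamma> + 3*\<beta>*\<gamma> = 0" using a by simp
    have b0: "\<beta> \<noteq> 0" using e7 c by (auto simp: algebra_simps)
    have "\<beta> * (\<beta>+\<alpha>*\<beta>-1) = 0" "\<beta> * (\<alpha>+\<beta>*\<gamma>-\<gamma>) = 0"
      using 1 by algebra+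
    then have e: "\<beta>+\<alpha>*\<beta>=1" "\<alpha>+\<beta>*\<gamma> = \<gamma>" using b0 by auto
    have "\<alpha> * (\<beta> * \<gamma> - 1) = 0" using e by algebra
    then have bc: "\<beta> * \<gamma> = 1" using a by simp
    have "2 * (\<beta> - 1) * (2 * \<beta> - 1) = 0" using bc e e7 by algebra
    moreover have "\<beta> \<noteq> 1" using e a by auto
    ultimately have "2*\<beta> = 1" by simp
    moreover have "\<gamma> = 2" using bc \<open>2*\<beta> = 1\<close> by algebra
    moreover have "\<alpha> = 1" using e \<open>2*\<beta> = 1\<close> \<open>\<gamma> = 2\<close> by algebra
    ultimately show ?case using b by simp
  qed
  \<comment> \<open>At this isolated point the relation for \<open>(e1, e1)\<close> holds with
    \<open>f = -1\<close>, \<open>g = 0\<close>, so the other pairs must be used.\<close>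
  have False if b: "2*\<beta> = 1" "\<alpha> = 1" "\<gamma> = 2"
    using D[of e1 e1, unfolded bracket_dep_simps, simplified] D[of e2 e2, unfolded bracket_dep_simps, simplified]
       D[of e1 e2, unfolded bracket_dep_simps, simplified] D[of e2 e1, unfolded bracket_dep_simps, simplified]
  proof (elim exE conjE, goal_cases)
    case (1 f1 g1 f2 g2 f3 g3 f4 g4)
    have b: "\<beta> = 1/2" "\<alpha> = 1" "\<gamma> = 2" using b by (auto simp: field_simps)
    show ?case using 1[unfolded b, simplified] by algebra
  qed
  then show ?thesis using A B by blast
qed

lemma algebra_iso_swap:
  "algebra_iso (*s) (tab a1 a2 b1 b2 c1 c2 d1 d2) (*s) (tab d2 d1 c2 c1 b2 b1 a2 a1 :: 'k::field ^ 2 \<Rightarrow> _)"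
  by (rule algebra_iso_tab_basis[of _ e2 e1]) (simp_all add: bilinear_tab e_nth vec2_eq_iff tab_nth)

lemma one_diff_eq_iff: "1 - x = y \<longleftrightarrow> y + x = (1 :: 'k::field)"
  by (auto simp: diff_eq_eq)

text \<open>The second coordinate of \<open>[L_2, P](e1, e1)\<close> is
  \<open>\<delta> * (1 - \<delta> - \<beta>)\<close>, while \<open>[L_1, P](e1, e1)\<close> and
  \<open>[L_1, [L_1, P]](e1, e1)\<close> have second coordinate 0. This gives \<open>g = 0\<close>,
  hence \<open>f = -1\<close>, and the conclusion lists coordinates of
  \<open>[L_1, [L_1, P]] + [L_1, P] = 0\<close>.\<close>

lemma conservative_E_generic_half:
  fixes \<alpha> \<beta> \<gamma> \<delta> :: "'k::field_char_0"
  assumes "conservative (*s) (tab 1 0 \<alpha> \<beta> \<gamma> \<delta> 0 1)" "\<delta> * (1 - \<delta> - \<beta>) \<noteq> 0"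
  shows "\<beta> * (\<gamma> + (\<delta>*\<alpha> - \<alpha> - \<beta>*\<gamma>)) = 0 \<and> \<beta> * (1 - \<beta> - \<alpha>*\<beta> - \<alpha>*\<delta>) = 0 \<and>
    \<alpha> * (2 * (1 - \<alpha> - \<gamma>) * (1 - \<beta>) - \<beta> - \<alpha>*\<beta> - \<alpha>*\<delta> + \<alpha> - (\<delta>*\<alpha> - \<alpha> - \<beta>*\<gamma>)) = 0"
  using conservative_bracket_dep[OF assms(1), of e1 e1, unfolded bracket_dep_simps, simplified]
proof (elim exE conjE, goal_cases)
  case (1 f g)
  have "g * (\<delta> * (1 - \<delta> - \<beta>)) = 0" using 1 by algebra
  then have g: "g = 0" using assms(2) by simp
  have f: "f = -1" using g 1 by algebra
  note 1 = 1[unfolded f g, simplified]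
  show ?case by (intro conjI; use 1 in algebra)
qed

lemma conservative_E_generic:
  fixes \<alpha> \<beta> \<gamma> \<delta> :: "'k::field_char_0"
  assumes C: "conservative (*s) (tab 1 0 \<alpha> \<beta> \<gamma> \<delta> 0 1)"
    and d: "\<delta> * (1 - \<delta> - \<beta>) \<noteq> 0" and a: "\<alpha> * (1 - \<alpha> - \<gamma>) \<noteq> 0"
  shows "\<alpha> = -1 \<and> \<beta> = 0 \<and> \<gamma> = 0 \<and> \<delta> = -1"
proof -
  note E = conservative_E_generic_half[OF assms(1,2)] conservative_E_generic_half[OF conservative_iso[OF algebra_iso_swap C] a]
  have nz: "\<alpha> \<noteq> 0" "\<delta> \<noteq> 0" "1 - \<alpha> - \<gamma> \<noteq> 0" "1 - \<delta> - \<beta> \<noteq> 0"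
    using a d by auto
  have bc: "\<beta> = 0 \<and> \<gamma> = 0"
  proof (rule ccontr)
    assume n: "\<not> ?thesis"
    show False
    proof (cases "\<beta> = 0 \<or> \<gamma> = 0")
      case True
      then show False using n nz E by auto algebra+
    next
      case False
      then have E': "\<gamma> + (\<delta>*\<alpha> - \<alpha> - \<beta>*\<gamma>) = 0" "1 - \<beta> - \<alpha>*\<beta> - \<alpha>*\<delta> = 0"
         "2 * (1 - \<alpha> - \<gamma>) * (1 - \<beta>) - \<beta> - \<alpha>*\<beta> - \<alpha>*\<delta> + \<alpha> - (\<delta>*\<alpha> - \<alpha> - \<beta>*\<gamma>) = 0"
         "\<beta> + (\<alpha>*\<delta> - \<delta> - \<gamma>*\<beta>) = 0" "1 - \<gamma> - \<delta>*\<gamma> - \<delta>*\<alpha> = 0"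
        using E nz by auto
      have s: "\<alpha> + \<gamma> = \<beta> + \<delta>" using E' by algebra
      have "(\<alpha> + \<gamma> - 1) * (\<alpha> + \<gamma> + 2) = 0" using s E' by algebra
      then have s': "\<alpha> + \<gamma> + 2 = 0" using nz(3) by (auto simp: one_diff_eq_iff add.commute)
      have "3 * (\<alpha> + 1) = 0" using E' s s' by algebra
      then have "\<alpha> + 1 = 0" by (simp del: distrib_left_numeral)
      then have "\<alpha> = -1" by (simp add: eq_neg_iff_add_eq_0)
      moreover have "(9::'k) = 0" using E' s s' \<open>\<alpha> = -1\<close> by algebra
      ultimately show False by simp
    qed
  qed
  then have "2 * \<alpha> * (1 - \<alpha> * \<delta>) = 0" using E by algebra
  then have ad: "\<alpha> * \<delta> = 1" using nz by simp
  \<comment> \<open>All points of the curve \<open>\<beta> = \<gamma> = 0\<close>,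
    \<open>\<alpha> * \<delta> = 1\<close> satisfy the relations for \<open>(e1, e1)\<close> and
    \<open>(e2, e2)\<close>. The mixed pair singles out one of them, which is
    \<open>C16\<close>.\<close>
  have "\<alpha> = -1"
    using conservative_bracket_dep[OF assms(1), of e1 e2, unfolded bc bracket_dep_simps, simplified]
  proof (elim exE conjE, goal_cases)
    case (1 f g)
    have "\<alpha> * (1 - \<alpha> - \<gamma>) * (f + 2) = 0" "\<delta> * (1 - \<delta> - \<beta>) * (g + 1) = 0"
      using 1 bc by algebra+
    then have "f + 2 = 0" "g + 1 = 0" using a d by auto
    then show ?case using 1 ad bc by algebra
  qed
  moreover have "\<delta> = -1" using ad calculation by algebra
  ultimately show ?thesis using bc by simp
qed
text \<open>The conclusion describes \<open>C17 \<beta>\<close>. Since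
  \<open>\<delta> * (1 - \<delta> - \<beta>)\<close> vanishes here,
  \<open>conservative_E_generic_half\<close> can only be applied to the swapped algebra, where it
  forces \<open>\<alpha> + \<gamma> = 1\<close>.\<close>

lemma conservative_E_row_sum_1:
  fixes \<alpha> \<beta> \<gamma> \<delta> :: "'k::field_char_0"
  assumes C: "conservative (*s) (tab 1 0 \<alpha> \<beta> \<gamma> \<delta> 0 1)"
    and d: "\<delta> \<noteq> 0" "\<beta> + \<delta> = 1"
  shows "\<alpha> = \<delta> \<and> \<gamma> = \<beta>"
proof -
  have b: "\<beta> = 1 - \<delta>" using d by (simp add: algebra_simps)
  note C' = conservative_iso[OF algebra_iso_swap C]
  have a: "\<alpha> \<noteq> 0"
  proof
    assume "\<alpha> = 0"
    with C' have "conservative (*s) (tab 1 0 \<delta> \<gamma> \<beta> 0 0 1)" by simp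
    from conservative_E_delta_0[OF this] show False using d by simp
  qed
  have ac: "\<alpha> + \<gamma> = 1"
  proof (rule ccontr)
    assume n: "\<alpha> + \<gamma> \<noteq> 1"
    with a have "\<alpha> * (1 - \<alpha> - \<gamma>) \<noteq> 0" by (simp add: one_diff_eq_iff add.commute)
    from conservative_E_generic_half[OF C' this] have "\<delta> * (2 * \<delta> * (1 - \<gamma> - \<alpha>)) = 0"
      using d by algebra
    then show False using n d(1) by (simp add: one_diff_eq_iff)
  qed
  have "\<gamma> = \<beta>"
    using conservative_bracket_dep[OF C, of e1 e1, unfolded bracket_dep_simps, simplified]
      conservative_bracket_dep[OF C, of e2 e2, unfolded bracket_dep_simps, simplified]
  proof (elim exE conjE, goal_cases)
    case (1 f f' g g')
    have "\<delta> * (f + g + 1) = 0" using 1 by algebra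
    then have fg: "f + g + 1 = 0" using d by simp
    have "\<alpha> * (f' + g' + 1) = 0" using 1 by algebra
    then have fg': "f' + g' + 1 = 0" using a by simp
    show ?case
    proof (rule ccontr)
      assume n: "\<not> ?case"
      have "g * (\<beta> - \<gamma>) = 0" using fg 1 ac d by algebra
      then have g: "g = 0" using n by simp
      have "f' * (\<beta> - \<gamma>) = 0" using fg' 1 ac d by algebra
      then have f': "f' = 0" using n by simp
      have "\<beta> * (\<beta> - \<gamma>) = 0" using 1 g fg ac d by algebra
      moreover have "\<gamma> * (\<beta> - \<gamma>) = 0" using 1 f' fg' ac d by algebra
      ultimately show False using n by simp
    qed
  qed
  moreover have "\<alpha> = \<delta>" using ac d calculation by algebra
  ultimately show ?thesis by simp
qed

text \<open>The cases follow the factors of \<open>\<delta> * (1 - \<delta> - \<beta>)\<close> and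
  \<open>\<alpha> * (1 - \<alpha> - \<gamma>)\<close>, whose nonvanishing kills \<open>g\<close> for
  the pair \<open>(e1, e1)\<close> and \<open>f\<close> for the pair
  \<open>(e2, e2)\<close>.\<close>

lemma conservative_E:
  fixes \<alpha> \<beta> \<gamma> \<delta> :: "'k::field_char_0"
  assumes C: "conservative (*s) (tab 1 0 \<alpha> \<beta> \<gamma> \<delta> 0 1)"
  shows "(\<alpha> = 0 \<and> \<delta> = 0 \<and> (\<beta> * \<gamma> = 1 \<longrightarrow> \<beta> = 1)) \<or> (\<gamma> = 1 \<and> \<delta> = 0) \<or> (\<alpha> = 0 \<and> \<beta> = 1) \<or>
    (\<alpha> = -1 \<and> \<beta> = 0 \<and> \<gamma> = 0 \<and> \<delta> = -1) \<or> (\<beta> + \<delta> = 1 \<and> \<alpha> = \<delta> \<and> \<gamma> = \<beta>)"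
proof -
  note C' = conservative_iso[OF algebra_iso_swap C]
  consider "\<delta> = 0" | "\<alpha> = 0" | "\<delta> \<noteq> 0" "\<beta> + \<delta> = 1" | "\<alpha> \<noteq> 0" "\<gamma> + \<alpha> = 1"
    | "\<delta> * (1 - \<delta> - \<beta>) \<noteq> 0" "\<alpha> * (1 - \<alpha> - \<gamma>) \<noteq> 0"
    by (auto simp: one_diff_eq_iff mult_eq_0_iff)
  then show ?thesis
  proof cases
    case 1 then show ?thesis using conservative_E_delta_0[of \<alpha> \<beta> \<gamma>] C by auto
  next
    case 2 then show ?thesis using conservative_E_delta_0[of \<delta> \<gamma> \<beta>] C'
      by (auto simp: mult.commute)
  next
    case 3 then show ?thesis using conservative_E_row_sum_1[OF C 3] by (auto simp: algebra_simps)
  next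
    case 4 then show ?thesis using conservative_E_row_sum_1[OF C' 4] by (auto simp: algebra_simps)
  next
    case 5 then show ?thesis using conservative_E_generic[OF C 5] by auto
  qed
qed

section \<open>Roots of polynomials and bases adapted to idempotents\<close>

lemma quadratic_root:
  fixes a b c :: "'k::alg_closed_field"
  assumes "a \<noteq> 0 \<or> b \<noteq> 0"
  shows "\<exists>t. c + b * t + a * t^2 = 0"
proof -
  have "degree [:c, b, a:] > 0" using assms by auto
  from alg_closed_imp_poly_has_root[OF this] show ?thesis
    by (auto simp: algebra_simps power2_eq_square)
qed

lemma cubic_root:
  fixes a b c d :: "'k::alg_closed_field"
  assumes "a \<noteq> 0"
  shows "\<exists>t. d + c * t + b * t^2 + a * t^3 = 0"
proof -
  have "degree [:d, c, b, a:] > 0" using assms by auto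
  from alg_closed_imp_poly_has_root[OF this] show ?thesis
    by (auto simp: algebra_simps power2_eq_square power3_eq_cube)
qed

definition many_idempotents :: "('k::field ^ 2 \<Rightarrow> 'k ^ 2 \<Rightarrow> 'k ^ 2) \<Rightarrow> bool" where
  "many_idempotents P \<longleftrightarrow> (\<exists>x y. x \<noteq> 0 \<and> y \<noteq> 0 \<and> x \<noteq> y \<and> P x x = x \<and> P y y = y)"

lemma algebra_iso_basis:
  fixes P :: "'k::field ^ 2 \<Rightarrow> 'k ^ 2 \<Rightarrow> 'k ^ 2"
  assumes bil: "bilinear_mult (*s) P" and uv: "u $ 1 * v $ 2 \<noteq> u $ 2 * v $ 1"
    and "P u u = a1 *s u + a2 *s v" "P v v = d1 *s u + d2 *s v"
  shows "\<exists>b1 b2 c1 c2. algebra_iso (*s) P (*s) (tab a1 a2 b1 b2 c1 c2 d1 d2)"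
  using algebra_iso_tab_basis[OF bil uv assms(3) _ _ assms(4)] exists_comb[OF uv] by meson

lemma exists_complement:
  fixes v :: "'k::field ^ 2"
  assumes "v \<noteq> 0"
  shows "\<exists>u :: 'k ^ 2. v$1 * u$2 \<noteq> v$2 * u$1"
proof (cases "v $ 1 = 0")
  case True
  then show ?thesis using assms by (intro exI[of _ e1]) (simp add: vec2_eq_iff e_nth)
next
  case False
  then show ?thesis by (intro exI[of _ e2]) (simp add: e_nth)
qed

lemma parallel_scale:
  fixes u v :: "'k::field ^ 2"
  assumes "u$1 * v$2 = u$2 * v$1" "u \<noteq> 0"
  shows "\<exists>c. v = c *s u"
proof (cases "u$1 = 0")
  case True
  then show ?thesis using assms by (intro exI[of _ "v$2 / u$2"]) (auto simp: vec2_eq_iff field_simps)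
next
  case False
  then show ?thesis using assms by (intro exI[of _ "v$1 / u$1"]) (auto simp: vec2_eq_iff field_simps)
qed

lemma tab_scale:
  "tab a1 a2 b1 b2 c1 c2 d1 d2 (k *s x) (l *s y) = (k * l) *s tab a1 a2 b1 b2 c1 c2 d1 d2 x y"
  by (simp add: vec2_eq_iff tab_nth algebra_simps)

lemma many_idempotents_E:
  assumes "many_idempotents P" and P: "P = tab p1 p2 q1 q2 r1 r2 s1 s2"
  shows "\<exists>\<alpha> \<beta> \<gamma> \<delta>. algebra_iso (*s) P (*s) (tab 1 0 \<alpha> \<beta> \<gamma> \<delta> 0 1)"
proof -
  obtain x y where xy: "x \<noteq> 0" "y \<noteq> 0" "x \<noteq> y" "P x x = x" "P y y = y"
    using assms unfolding many_idempotents_def by blast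
  have "x$1 * y$2 \<noteq> x$2 * y$1"
  proof
    assume "x$1 * y$2 = x$2 * y$1"
    then obtain c where c: "y = c *s x" using parallel_scale xy by blast
    then have "(c * c) *s x = c *s x" using xy(4,5) by (simp add: P tab_scale)
    then have "c * c = c" using xy(1) by simp
    then show False using xy c by auto
  qed
  then show ?thesis
    using xy by (intro algebra_iso_basis[of P x y]) (simp_all add: P bilinear_tab)
qed

section \<open>Matching tables with two idempotents against the list\<close>

definition classified :: "'k::field set \<Rightarrow> 'k triple set \<Rightarrow> ('k ^ 2 \<Rightarrow> 'k ^ 2 \<Rightarrow> 'k ^ 2) \<Rightarrow> bool" where
  "classified K W P \<longleftrightarrow> (\<exists>l. listed K W l \<and> algebra_iso (*s) P (*s) (calg l)) \<or>
     algebra_iso (*s) P (*s) alg_omitted"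

lemma classified_iso:
  assumes "algebra_iso (*s) P (*s) Q" "classified K W Q"
  shows "classified K W P"
  using assms algebra_iso_trans unfolding classified_def by blast

lemma algebra_iso_refl: "algebra_iso (*s) (tab p1 p2 q1 q2 r1 r2 s1 s2) (*s) (tab p1 p2 q1 q2 r1 r2 s1 s2)"
  by (rule algebra_iso_tab_basis[of _ e1 e2]) (simp_all add: bilinear_tab e_nth vec2_eq_iff tab_nth)

lemma classified_calg:
  assumes "tab p1 p2 q1 q2 r1 r2 s1 s2 = calg l" "listed K W l"
  shows "classified K W (tab p1 p2 q1 q2 r1 r2 s1 s2)"
  unfolding classified_def using assms algebra_iso_refl by metis

lemma classified_swap:
  "classified K W (tab d2 d1 c2 c1 b2 b1 a2 a1) \<Longrightarrow> classified K W (tab a1 a2 b1 b2 c1 c2 d1 d2)"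
  by (rule classified_iso[OF algebra_iso_swap])

lemma classified_calg_swap:
  assumes "tab d2 d1 c2 c1 b2 b1 a2 a1 = calg l" "listed K W l"
  shows "classified K W (tab a1 a2 b1 b2 c1 c2 d1 d2)"
  using assms by (intro classified_swap[OF classified_calg])

text \<open>\<open>adapted_reps\<close> only guarantees that one of
  \<open>(0, \<beta>, \<gamma>, 0)\<close> and \<open>(0, \<gamma>, \<beta>, 0)\<close> is
  admissible; exchanging \<open>e1\<close> and \<open>e2\<close> passes from one to the
  other.\<close>

lemma classified_C11:
  assumes "adapted_reps W" "\<beta> \<noteq> 1" "\<gamma> \<noteq> 1" "\<beta> * \<gamma> \<noteq> 1"
  shows "classified K W (tab 1 0 0 \<beta> \<gamma> 0 0 1)"
proof -
  have "(0, \<beta>, \<gamma>, 0) \<in> generic_params"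
    using assms(2-) by (simp add: generic_params_def calT_def mult.commute)
  then consider "(0, \<beta>, \<gamma>, 0) \<in> calV W" | "(0, \<gamma>, \<beta>, 0) \<in> calV W"
    using assms(1) unfolding adapted_reps_def by blast
  then show ?thesis
  proof cases
    case 1 then show ?thesis
      by (intro classified_calg[of _ _ _ _ _ _ _ _ "C11 \<beta> \<gamma>"]) (simp_all only: calg_tab listed.simps)
  next
    case 2 then show ?thesis
      by (intro classified_calg_swap[of _ _ _ _ _ _ _ _ "C11 \<gamma> \<beta>"]) (simp_all only: calg_tab listed.simps)
  qed
qed

text \<open>An idempotent \<open>y e1 + z e2\<close> off the two axes solves
  \<open>y + (1 + x) z = 1\<close> and \<open>a y + z = 1\<close>, and the cases follow the
  solutions of this linear system. In the last case there is a third idempotent, and using it in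
  place of \<open>e2\<close> turns the table into that of \<open>C11\<close>.\<close>

lemma classified_gamma_1:
  assumes W: "adapted_reps W" and K: "inversion_reps K"
  shows "classified K W (tab 1 0 x a 1 0 0 1)"
proof -
  consider "x = 0" "a = 1" | "x = 0" "a \<noteq> 1" | "x \<noteq> 0" "a = 1" |
    "x \<noteq> 0" "a \<noteq> 1" "(1 + x) * a = 1" | "x \<noteq> 0" "a \<noteq> 1" "(1 + x) * a \<noteq> 1"
    by blast
  then show ?thesis
  proof cases
    case 1 then show ?thesis
      by (intro classified_calg[of _ _ _ _ _ _ _ _ "C17 1"]) (simp_all add: calg_tab del: calg.simps)
  next
    case 2 then show ?thesis
      by (intro classified_calg[of _ _ _ _ _ _ _ _ "C13 a"]) (simp_all add: calg_tab del: calg.simps)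
  next
    case 3 then show ?thesis
      by (intro classified_calg_swap[of _ _ _ _ _ _ _ _ "C12 x"]) (simp_all add: calg_tab del: calg.simps)
  next
    case 4
    have a0: "a \<noteq> 0" using 4 by auto
    have x: "x = 1 / a - 1" using 4 a0 by (simp add: field_simps)
    \<comment> \<open>The table is \<open>C15 (inverse a)\<close>, and after exchanging
      \<open>e1\<close> and \<open>e2\<close> it is \<open>C14 a\<close>. The list contains it under
      whichever of the two parameters lies in \<open>K\<close>.\<close>
    have "a \<in> UNIV - {0, 1}" using 4 a0 by simp
    then obtain r where "r \<in> K" "r = a \<or> r = inverse a"
      using K unfolding inversion_reps_def orbit_reps_def by blast
    then consider "a \<in> K" | "inverse a \<in> K" by blast
    then show ?thesis
    proof cases
      case 1
      then show ?thesis using a0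
        by (intro classified_calg_swap[of _ _ _ _ _ _ _ _ "C14 a"])
          (simp_all add: calg_tab x diff_divide_distrib del: calg.simps)
    next
      case 2
      then show ?thesis using a0
        by (intro classified_calg[of _ _ _ _ _ _ _ _ "C15 (inverse a)"])
          (simp_all add: calg_tab x field_simps del: calg.simps)
    qed
  next
    case 5
    define D where "D = (1 + x) * a - 1"
    have D: "D \<noteq> 0" using 5 by (simp add: D_def)
    \<comment> \<open>\<open>b\<close> is the first component of \<open>calC3 (x, a, 1, 0)\<close>.
      Below, \<open>w = vec2 p q\<close> is the third idempotent, found by Cramer's rule; as
      \<open>e1 e1 = e2 e1 = e1\<close>, one has \<open>w e1 = (p + q) e1\<close>, which explains
      \<open>b = p + q\<close>.\<close>
    define b where "b = (x + a - 1) / D"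
    have bD: "b * D = x + a - 1" using D by (simp add: b_def)
    define p q where "p = x / D" and "q = (a - 1) / D"
    have pq: "p * D = x" "q * D = a - 1" using D by (simp_all add: p_def q_def)
    have "(p + (1 + x) * q - 1) * D = p * D + (1 + x) * (q * D) - D"
      "(a * p + q - 1) * D = a * (p * D) + q * D - D" "(p + q - b) * D = p * D + q * D - b * D"
      by (simp_all add: algebra_simps)
    then have "(p + (1 + x) * q - 1) * D = 0" "(a * p + q - 1) * D = 0" "(p + q - b) * D = 0"
      unfolding pq bD by (simp_all add: D_def algebra_simps)
    then have w: "p + (1 + x) * q = 1" "a * p + q = 1" "b = p + q" using D by simp_all
    have "q \<noteq> 0" using pq 5 by auto
    then have "algebra_iso (*s) (tab 1 0 x a 1 0 0 1) (*s) (tab 1 0 0 a b 0 0 1)"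
    proof (intro algebra_iso_tab_basis[of _ e1 "vec2 p q"])
      have "p * p + x * p * q + p * q = p" "a * p * q + q * q = q" using w by algebra+
      then show "tab 1 0 x a 1 0 0 1 (vec2 p q) (vec2 p q) = 0 *s e1 + 1 *s vec2 p q"
        by (simp add: vec2_eq_iff tab_nth e_nth algebra_simps)
      have "p + x * q = a * p" using w by algebra
      then show "tab 1 0 x a 1 0 0 1 e1 (vec2 p q) = 0 *s e1 + a *s vec2 p q"
        by (simp add: vec2_eq_iff tab_nth e_nth algebra_simps)
    qed (simp_all add: bilinear_tab vec2_eq_iff tab_nth e_nth w(3))
    moreover have "classified K W (tab 1 0 0 a b 0 0 1)"
    proof (rule classified_C11[OF W])
      show "a \<noteq> 1" by (fact 5(2))
      show "b \<noteq> 1"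
      proof
        assume "b = 1"
        then have "x * (a - 1) = 0" using bD D_def by algebra
        then show False using 5 by simp
      qed
      show "a * b \<noteq> 1"
      proof
        assume "a * b = 1"
        then have "(a - 1) * (a - 1) = 0" using bD D_def by algebra
        then show False using 5 by simp
      qed
    qed
    ultimately show ?thesis by (rule classified_iso)
  qed
qed

lemma classified_E:
  fixes \<alpha> \<beta> \<gamma> \<delta> :: "'k::field_char_0"
  assumes W: "adapted_reps W" and K: "inversion_reps K"
    and C: "conservative (*s) (tab 1 0 \<alpha> \<beta> \<gamma> \<delta> 0 1)"
  shows "classified K W (tab 1 0 \<alpha> \<beta> \<gamma> \<delta> 0 1)"
proof -
  consider "\<alpha> = 0" "\<delta> = 0" "\<beta> \<noteq> 1" "\<gamma> \<noteq> 1" "\<beta> * \<gamma> \<noteq> 1" | "\<gamma> = 1" "\<delta> = 0" | "\<alpha> = 0" "\<beta> = 1"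
    | "\<alpha> = -1" "\<beta> = 0" "\<gamma> = 0" "\<delta> = -1" | "\<beta> + \<delta> = 1" "\<alpha> = \<delta>" "\<gamma> = \<beta>"
    using conservative_E[OF C] by blast
  then show ?thesis
  proof cases
    case 1 then show ?thesis using classified_C11[OF W] by simp
  next
    case 2 then show ?thesis using classified_gamma_1[OF W K] by simp
  next
    case 3 then show ?thesis using classified_gamma_1[OF W K] by simp (rule classified_swap)
  next
    case 4 then show ?thesis
      by (intro classified_calg[of _ _ _ _ _ _ _ _ "C16"]) (simp_all add: calg_tab del: calg.simps)
  next
    case 5
    then have "\<delta> = 1 - \<beta>" by (simp add: algebra_simps)
    then show ?thesis using 5
      by (intro classified_calg[of _ _ _ _ _ _ _ _ "C17 \<beta>"]) (simp_all add: calg_tab del: calg.simps)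
  qed
qed

lemma classified_many:
  fixes P :: "'k::field_char_0 ^ 2 \<Rightarrow> 'k ^ 2 \<Rightarrow> 'k ^ 2"
  assumes W: "adapted_reps W" and K: "inversion_reps K"
    and "conservative (*s) P" "many_idempotents P" "P = tab p1 p2 q1 q2 r1 r2 s1 s2"
  shows "classified K W P"
proof -
  obtain \<alpha> \<beta> \<gamma> \<delta> where i: "algebra_iso (*s) P (*s) (tab 1 0 \<alpha> \<beta> \<gamma> \<delta> 0 1)"
    using many_idempotents_E[OF assms(4,5)] by (elim exE)
  show ?thesis
    by (rule classified_iso[OF i classified_E[OF W K conservative_iso[OF i assms(3)]]])
qed

section \<open>Algebras with at most one idempotent\<close>

lemma conservative_one_idempotent:
  fixes a b \<alpha> \<beta> :: "'k::field_char_0"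
  assumes C: "conservative (*s) (tab 1 0 a \<alpha> b \<beta> 0 0)"
    and n: "a + b = 0 \<or> \<alpha> + \<beta> = 0 \<or> \<alpha> + \<beta> = 1"
  shows "(a = 0 \<and> b = 0) \<or> (\<alpha> = 0 \<and> \<beta> = 0 \<and> (a = 0 \<or> b = 0)) \<or> (a = 0 \<and> \<alpha> = 1 \<and> (\<beta> = 0 \<or> \<beta> = -1))"
proof -
  \<comment> \<open>On the families of \<open>S1\<close>, \<open>S2\<close> and \<open>S3\<close>
    one has \<open>[L_1, [L_1, P]] = - [L_1, P]\<close>, so the pair \<open>(e1, e1)\<close> cannot
    exclude them.\<close>
  have S1: False if s: "\<alpha> = 0" "\<beta> = 1" "b = -a" and a: "a \<noteq> 0"
    using conservative_bracket_dep[OF C, unfolded s bracket_dep_simps, simplified, of e1 e1]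
       conservative_bracket_dep[OF C, of e2 e2, unfolded s bracket_dep_simps, simplified]
       conservative_bracket_dep[OF C, of e1 e2, unfolded s bracket_dep_simps, simplified]
       conservative_bracket_dep[OF C, of e2 e1, unfolded s bracket_dep_simps, simplified]
  proof (elim exE conjE, goal_cases)
    case 1
    then show ?case using a by simp
  qed
  have S2: False if s: "\<alpha> = 1/2" "\<beta> = -1/2" "b = 3*a" and a: "a \<noteq> 0"
    using conservative_bracket_dep[OF C, of e1 e1, unfolded s bracket_dep_simps, simplified]
       conservative_bracket_dep[OF C, of e2 e2, unfolded s bracket_dep_simps, simplified]
       conservative_bracket_dep[OF C, of e1 e2, unfolded s bracket_dep_simps, simplified]
       conservative_bracket_dep[OF C, of e2 e1, unfolded s bracket_dep_simps, simplified]
  proof (elim exE conjE, goal_cases)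
    case 1
    then show ?case using a by simp
  qed
  have S3: False if s: "\<alpha> = 0" "\<beta> = 1" "a = 0" and a: "b \<noteq> 0"
    using conservative_bracket_dep[OF C, of e1 e1, unfolded s bracket_dep_simps, simplified]
       conservative_bracket_dep[OF C, of e2 e2, unfolded s bracket_dep_simps, simplified]
       conservative_bracket_dep[OF C, of e1 e2, unfolded s bracket_dep_simps, simplified]
       conservative_bracket_dep[OF C, of e2 e1, unfolded s bracket_dep_simps, simplified]
  proof (elim exE conjE, goal_cases)
    case 1
    then show ?case using a by simp
  qed
  show ?thesis
    using conservative_bracket_dep[OF C, of e1 e1, unfolded bracket_dep_simps, simplified]
  proof (elim exE conjE, goal_cases)
    case (1 f g)
    show ?case
    proof (cases "a = 0")
      case False
      have "a * (f + 1) = 0" using 1 by algebra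
      then have f: "f = -1" using False by (simp add: add_eq_0_iff2)
      have "a * (\<alpha> * (\<alpha> + \<beta>)) = 0" "a * (-2*b + a*\<alpha> - 2*a*\<beta> + 3*\<alpha>*b) = 0" "\<alpha> * (b + \<beta>*a - a - \<alpha>*b) = 0"
        using 1 f by algebra+
      then have e: "\<alpha> * (\<alpha> + \<beta>) = 0" "-2*b + a*\<alpha> - 2*a*\<beta> + 3*\<alpha>*b = 0" "\<alpha> * (b + \<beta>*a - a - \<alpha>*b) = 0"
        using False by simp_all
      show ?thesis
      proof (cases "\<alpha> = 0")
        case True
        have "2 * (b + a * \<beta>) = 0" using e True by algebra
        then have b: "b = - (a * \<beta>)" by (simp add: add_eq_0_iff2 del: distrib_left_numeral)
        then have "\<beta> = 1 \<or> \<beta> = 0" using n True False by (auto simp: add_eq_0_iff)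
        then show ?thesis using S1 True False b by auto
      next
        case al: False
        then have e': "\<beta> = - \<alpha>" "b + \<beta>*a - a - \<alpha>*b = 0" using e
          by (auto simp: add_eq_0_iff)
        have "2 * a * (2 * \<alpha> - 1) = 0" using e(2) e' by algebra
        then have "2 * \<alpha> = 1" using False by simp
        then have "\<alpha> = 1/2" by (simp add: field_simps)
        moreover have "b = 3 * a" using \<open>2 * \<alpha> = 1\<close> e' by algebra
        ultimately show ?thesis using S2 e' False by simp
      qed
    next
      case True
      show ?thesis
      proof (cases "b = 0")
        case b: False
        have *: "\<alpha> * (b * (1 - \<alpha>)) = 0" if "g = 0" using 1 that True by algebra
        consider "\<beta> = - \<alpha>" "\<alpha> \<noteq> 0" | "\<alpha> = 0" "\<beta> = 0" | "\<beta> = 1 - \<alpha>" "\<alpha> \<noteq> 0" | "\<beta> = 1" "\<alpha> = 0"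
          using n True b by (cases "\<alpha> = 0") (auto simp: eq_diff_eq add.commute add_eq_0_iff)
        then show ?thesis
        proof cases
          case c: 1
          have "\<alpha> * g = 0" using 1 c True by algebra
          then show ?thesis using * c True b by auto
        next
          case c: 3
          have "\<alpha> * (g * ((1 - \<alpha>) * b)) = 0" using 1 c True by algebra
          then show ?thesis using * c True b by auto
        qed (use True S3 b in auto)
      qed (use True in simp)
    qed
  qed
qed

text \<open>For this table \<open>x \<and> x\<^sup>2\<close> equals \<open>- c * x_2^3\<close>, so
  the line of \<open>e1\<close> is a triple zero. The point \<open>\<alpha> = 1/2\<close>,
  \<open>a = 0\<close> is treated apart because there the relation for \<open>(e1, e1)\<close> holds
  with \<open>f = -1\<close>, \<open>g = 0\<close>.\<close>

lemma conservative_one_idempotent_line: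
  fixes a c \<alpha> :: "'k::field_char_0"
  assumes C: "conservative (*s) (tab 1 0 a \<alpha> (-a) (1 - \<alpha>) c 0)" and c: "c \<noteq> 0"
  shows "a = 0 \<and> \<alpha> = 1"
proof -
  have S: False if s: "\<alpha> = 1/2" "a = 0"
    using conservative_bracket_dep[OF C, of e1 e1, unfolded s bracket_dep_simps, simplified]
       conservative_bracket_dep[OF C, of e2 e2, unfolded s bracket_dep_simps, simplified]
       conservative_bracket_dep[OF C, of e1 e2, unfolded s bracket_dep_simps, simplified]
       conservative_bracket_dep[OF C, of e2 e1, unfolded s bracket_dep_simps, simplified]
  proof (elim exE conjE, goal_cases)
    case 1
    then show ?case using c by simp
  qed
  show ?thesis
    using conservative_bracket_dep[OF C, of e1 e1, unfolded bracket_dep_simps, simplified]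
  proof (elim exE conjE, goal_cases)
    case (1 f g)
    have "g * a * (1 - \<alpha>) = 0" "g * (a * a + 2 * (1 - \<alpha>) * c) = 0" using 1 by algebra+
    then consider "g = 0" | "\<alpha> = 1" "a = 0" using c by auto
    then show ?case
    proof cases
      case g: 1
      have "a * \<alpha> = 0" "2 * c * ((1 - 2 * \<alpha>) * (1 - \<alpha>)) = 0" using 1 g by algebra+
      then have "a * \<alpha> = 0" "2 * \<alpha> = 1 \<or> \<alpha> = 1" using c by auto
      then show ?thesis using S by (auto simp: field_simps)
    qed simp
  qed
qed

lemma conservative_two_nil:
  fixes a b \<alpha> :: "'k::field_char_0"
  assumes C: "conservative (*s) (tab 0 0 a \<alpha> b (-\<alpha>) 0 0)"
  shows "\<alpha> = 0 \<or> a + b = 0"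
  using conservative_bracket_dep[OF C, of e1 e2, unfolded bracket_dep_simps, simplified]
proof (elim exE conjE, goal_cases)
  case (1 f g)
  have "\<alpha> * \<alpha> * (a + b) = 0" using 1 by algebra
  then show ?case by simp
qed

text \<open>For this table \<open>x \<and> x\<^sup>2\<close> equals \<open>x_1^3\<close>: the line
  of \<open>e2\<close>, which consists of elements of square zero, is a triple zero.\<close>

lemma conservative_one_nil:
  fixes a p \<alpha> :: "'k::field_char_0"
  assumes C: "conservative (*s) (tab p 1 a \<alpha> (-a) (p-\<alpha>) 0 0)"
  shows "a = 0 \<and> (p = 0 \<or> \<alpha> = p \<or> \<alpha> = 2 * p)"
  using conservative_bracket_dep[OF C, of e1 e1, unfolded bracket_dep_simps, simplified]
     conservative_bracket_dep[OF C, of e2 e2, unfolded bracket_dep_simps, simplified]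
     conservative_bracket_dep[OF C, of e1 e2, unfolded bracket_dep_simps, simplified]
     conservative_bracket_dep[OF C, of e2 e1, unfolded bracket_dep_simps, simplified]
proof (elim exE conjE, goal_cases)
  case (1 f fa fb fc g)
  have "a * a * p = 0" using 1 by algebra
  moreover have "a * a = 0" if "p = 0" using 1 that by algebra
  ultimately have a: "a = 0" by auto
  have "p * p * (f + p) = 0" using 1 a by algebra
  moreover have "(\<alpha> - p) * (\<alpha> - 2 * p) = 0" if "f = - p" using 1 a that by algebra
  ultimately show ?case using a by (auto simp: add_eq_0_iff2)
qed

lemma many_idempotents_iso:
  assumes "algebra_iso (*s) P (*s) Q" "many_idempotents P"
  shows "many_idempotents (Q :: 'k::field ^ 2 \<Rightarrow> _)"
proof -
  obtain f :: "'k ^ 2 \<Rightarrow> 'k ^ 2" where f: "Vector_Spaces.linear (*s) (*s) f" "bij f"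
    "\<And>x y. f (P x y) = Q (f x) (f y)"
    using assms(1) unfolding algebra_iso_def by blast
  interpret f: Vector_Spaces.linear "(*s)" "(*s)" f by (fact f(1))
  have inj: "f x = f y \<longleftrightarrow> x = y" for x y using f(2) by (simp add: bij_is_inj inj_eq)
  obtain x y where "x \<noteq> 0" "y \<noteq> 0" "x \<noteq> y" "P x x = x" "P y y = y"
    using assms(2) unfolding many_idempotents_def by blast
  then show ?thesis
    unfolding many_idempotents_def using f(3) inj f.zero by metis
qed

lemma algebra_iso_scale_basis:
  "algebra_iso (*s) (tab a1 a2 b1 b2 c1 c2 d1 d2) (*s)
     (tab (k*a1) (k*k*a2/l) (l*b1) (k*b2) (l*c1) (k*c2) (l*l*d1/k) (l*d2))"
  if "k \<noteq> 0" "l \<noteq> (0::'k::field)"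
  by (rule algebra_iso_tab_basis[of _ "k *s e1" "l *s e2"])
    (use that in \<open>simp_all add: bilinear_tab e_nth vec2_eq_iff tab_nth\<close>)

lemma classified_one_idempotent:
  fixes a b \<alpha> \<beta> :: "'k::field_char_0"
  assumes C: "conservative (*s) (tab 1 0 a \<alpha> b \<beta> 0 0)"
    and n: "\<not> many_idempotents (tab 1 0 a \<alpha> b \<beta> 0 0)"
  shows "classified K W (tab 1 0 a \<alpha> b \<beta> 0 0)"
proof -
  let ?P = "tab 1 0 a \<alpha> b \<beta> 0 0"
  have e1: "e1 \<noteq> (0 :: 'k^2)" by (simp add: vec2_eq_iff e_nth)
  have c: "a + b = 0 \<or> \<alpha> + \<beta> = 0 \<or> \<alpha> + \<beta> = 1"
  proof (rule ccontr)
    assume "\<not> ?thesis"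
    then have s: "a + b \<noteq> 0" "\<alpha> + \<beta> \<noteq> 0" "\<alpha> + \<beta> \<noteq> 1" by auto
    \<comment> \<open>An idempotent \<open>y e1 + z e2\<close> with \<open>y\<close> and
      \<open>z\<close> nonzero has to satisfy \<open>y * (\<alpha> + \<beta>) = 1\<close> and
      \<open>y + (a + b) * z = 1\<close>.\<close>
    define y where "y = 1 / (\<alpha> + \<beta>)"
    define z where "z = (1 - y) / (a + b)"
    have y: "y * (\<alpha> + \<beta>) = 1" and z: "(a + b) * z = 1 - y" using s by (simp_all add: y_def z_def)
    have "z \<noteq> 0" using y z s by auto
    have "y * y + (a + b) * z * y = y" "y * z * (\<alpha> + \<beta>) = z" using y z by algebra+
    then have "?P (vec2 y z) (vec2 y z) = vec2 y z"
      by (simp add: vec2_eq_iff tab_nth algebra_simps)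
    moreover have "?P e1 e1 = e1" by (simp add: vec2_eq_iff tab_nth e_nth)
    moreover have "vec2 y z \<noteq> 0" "vec2 y z \<noteq> e1" using \<open>z \<noteq> 0\<close>
      by (auto simp: vec2_eq_iff e_nth)
    ultimately show False using n e1 unfolding many_idempotents_def by blast
  qed
  consider "a = 0" "b = 0" | "\<alpha> = 0" "\<beta> = 0" "a = 0" "b \<noteq> 0" | "\<alpha> = 0" "\<beta> = 0" "b = 0" "a \<noteq> 0"
    | "a = 0" "\<alpha> = 1" "\<beta> = 0" "b \<noteq> 0" | "a = 0" "\<alpha> = 1" "\<beta> = -1" "b \<noteq> 0"
    using conservative_one_idempotent[OF C c] by blast
  then show ?thesis
  proof cases
    case 1
    have "\<alpha> + \<beta> \<noteq> 1"
    proof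
      assume "\<alpha> + \<beta> = 1"
      then have "?P (vec2 1 1) (vec2 1 1) = vec2 1 1" using 1 by (simp add: vec2_eq_iff tab_nth)
      moreover have "?P e1 e1 = e1" by (simp add: vec2_eq_iff tab_nth e_nth)
      moreover have "vec2 1 1 \<noteq> (0 :: 'k^2)" "vec2 1 1 \<noteq> (e1 :: 'k^2)"
        by (auto simp: vec2_eq_iff e_nth)
      ultimately show False using n e1 unfolding many_idempotents_def by blast
    qed
    then show ?thesis using 1
      by (intro classified_calg[of _ _ _ _ _ _ _ _ "C10 \<alpha> \<beta>"]) (simp_all add: calg_tab calT_def del: calg.simps)
  next
    case 2
    \<comment> \<open>The new second basis vector \<open>v = e1 - (1/b) e2\<close> spans the other
      line of square-zero elements; it satisfies \<open>e1 v = e1\<close> and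
      \<open>v e1 = 0\<close>.\<close>
    have "algebra_iso (*s) ?P (*s) (tab 1 0 1 0 0 0 0 0)"
      by (rule algebra_iso_tab_basis[of _ e1 "vec2 1 (- 1 / b)"])
        (use 2 in \<open>simp_all add: bilinear_tab e_nth vec2_eq_iff tab_nth\<close>)
    then show ?thesis
      by (rule classified_iso) (simp add: classified_calg[of _ _ _ _ _ _ _ _ C08] calg_tab del: calg.simps)
  next
    case 3
    have "algebra_iso (*s) ?P (*s) (tab 1 0 1 0 0 0 0 0)"
      using algebra_iso_scale_basis[of 1 "1 / a" 1 0 a \<alpha> b \<beta> 0 0] 3 by simp
    then show ?thesis
      by (rule classified_iso) (simp add: classified_calg[of _ _ _ _ _ _ _ _ C08] calg_tab del: calg.simps)
  next
    case 4
    have "algebra_iso (*s) ?P (*s) alg_omitted"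
      using algebra_iso_scale_basis[of 1 "1 / b" 1 0 a \<alpha> b \<beta> 0 0] 4 by (simp add: calg_tab)
    then show ?thesis by (simp add: classified_def)
  next
    case 5
    have "algebra_iso (*s) ?P (*s) (tab 1 0 0 1 1 (-1) 0 0)"
      using algebra_iso_scale_basis[of 1 "1 / b" 1 0 a \<alpha> b \<beta> 0 0] 5 by simp
    then show ?thesis
      by (rule classified_iso) (simp add: classified_calg[of _ _ _ _ _ _ _ _ C09] calg_tab del: calg.simps)
  qed
qed

lemma classified_one_idempotent_line:
  fixes a c \<alpha> :: "'k::{alg_closed_field, field_char_0}"
  assumes C: "conservative (*s) (tab 1 0 a \<alpha> (-a) (1 - \<alpha>) c 0)" and c: "c \<noteq> 0"
  shows "classified K W (tab 1 0 a \<alpha> (-a) (1 - \<alpha>) c 0)"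
proof -
  have s: "a = 0" "\<alpha> = 1" using conservative_one_idempotent_line[OF C c] by auto
  obtain r where r: "r ^ 2 = 1 / c" using nth_root_exists[of 2 "1/c"] by auto
  then have "r * r * c = 1" "r \<noteq> 0" using c by (auto simp: power2_eq_square)
  then have "algebra_iso (*s) (tab 1 0 a \<alpha> (-a) (1 - \<alpha>) c 0) (*s) (tab 1 0 0 1 0 0 1 0)"
    using algebra_iso_scale_basis[of 1 r 1 0 a \<alpha> "- a" "1 - \<alpha>" c 0] s by simp
  then show ?thesis
    by (rule classified_iso) (simp add: classified_calg_swap[of _ _ _ _ _ _ _ _ C07] calg_tab del: calg.simps)
qed

text \<open>With \<open>v = t e1 + e2\<close>, the quadratic in \<open>t\<close> is the
  \<open>e1\<close>-coefficient of \<open>v v\<close> in the basis \<open>e1\<close>,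
  \<open>v\<close>. A root makes \<open>v v\<close> a multiple of \<open>v\<close>, and this
  multiple is zero, as otherwise a second idempotent appears. There is no root only if the quadratic
  is a nonzero constant; then \<open>t = - d\<close> leads to the normal form of
  \<open>conservative_one_idempotent_line\<close>.\<close>

lemma classified_idempotent:
  fixes a b c d \<alpha> \<beta> :: "'k::{alg_closed_field, field_char_0}"
  assumes C: "conservative (*s) (tab 1 0 a \<alpha> b \<beta> c d)"
    and n: "\<not> many_idempotents (tab 1 0 a \<alpha> b \<beta> c d)"
  shows "classified K W (tab 1 0 a \<alpha> b \<beta> c d)"
proof -
  let ?P = "tab 1 0 a \<alpha> b \<beta> c d"
  have shift: "algebra_iso (*s) ?P (*s) (tab 1 0 (a + t - \<alpha>*t) \<alpha> (b + t - \<beta>*t) \<beta>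
      (c + (a + b - d) * t + (1 - \<alpha> - \<beta>) * t^2) (d + (\<alpha> + \<beta>) * t))" for t
    by (rule algebra_iso_tab_basis[of _ e1 "vec2 t 1"])
      (simp_all add: bilinear_tab e_nth vec2_eq_iff tab_nth algebra_simps power2_eq_square)
  have one: ?thesis if "algebra_iso (*s) ?P (*s) (tab 1 0 a' \<alpha>' b' \<beta>' 0 d')" for a' b' \<alpha>' \<beta>' d'
  proof -
    let ?Q = "tab 1 0 a' \<alpha>' b' \<beta>' 0 d'"
    have n': "\<not> many_idempotents ?Q"
      using n many_idempotents_iso algebra_iso_sym[OF that] by blast
    have "d' = 0"
    proof (rule ccontr)
      assume d: "d' \<noteq> 0"
      have "?Q e1 e1 = e1" "?Q (vec2 0 (1/d')) (vec2 0 (1/d')) = vec2 0 (1/d')"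
        using d by (simp_all add: vec2_eq_iff tab_nth e_nth)
      moreover have "e1 \<noteq> (0 :: 'k^2)" "vec2 0 (1/d') \<noteq> 0" "e1 \<noteq> vec2 0 (1/d')"
        using d by (auto simp: vec2_eq_iff e_nth)
      ultimately show False using n' unfolding many_idempotents_def by blast
    qed
    then show ?thesis
      using classified_iso[OF that] classified_one_idempotent[OF _ n'[unfolded \<open>d' = 0\<close>]] conservative_iso[OF that C] by blast
  qed
  show ?thesis
  proof (cases "\<alpha> + \<beta> \<noteq> 1 \<or> a + b \<noteq> d \<or> c = 0")
    case True
    have "\<exists>t. c + (a + b - d) * t + (1 - \<alpha> - \<beta>) * t^2 = 0"
    proof (cases "c = 0")
      case True then show ?thesis by (intro exI[of _ 0]) simp
    next
      case False then show ?thesis using \<open>_ \<or> _\<close>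
        by (intro quadratic_root) (auto simp: one_diff_eq_iff add.commute)
    qed
    then obtain t where t: "c + (a + b - d) * t + (1 - \<alpha> - \<beta>) * t^2 = 0" by blast
    from shift[of t] show ?thesis unfolding t by (rule one)
  next
    case False
    then have s: "\<beta> = 1 - \<alpha>" "d = a + b" "c \<noteq> 0" by (auto simp: eq_diff_eq add.commute)
    have e: "b + - d - \<beta> * - d = - (a + - d - \<alpha> * - d)" "c + (a + b - d) * - d + (1 - \<alpha> - \<beta>) * (- d)^2 = c"
      "d + (\<alpha> + \<beta>) * - d = 0"
      unfolding s by (simp_all add: algebra_simps)
    show ?thesis
      using shift[of "- d"] unfolding e unfolding s(1)
      using conservative_iso C[unfolded s(1)] classified_one_idempotent_line s(3) classified_iso by blast
  qed
qed

section \<open>Algebras without nonzero idempotents\<close>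

lemma nonzero_mult_iso:
  assumes "algebra_iso s P t Q" "\<exists>x y. P x y \<noteq> 0"
  shows "\<exists>x y. Q x y \<noteq> 0"
proof -
  obtain f where f: "Vector_Spaces.linear s t f" "bij f" "\<And>x y. f (P x y) = Q (f x) (f y)"
    using assms(1) unfolding algebra_iso_def by blast
  interpret f: Vector_Spaces.linear s t f by (fact f(1))
  have "f x = 0 \<longleftrightarrow> x = 0" for x using f(2) f.zero by (metis bij_is_inj injD)
  then show ?thesis using assms(2) f(3) by metis
qed

definition idempotent_free :: "('k::field ^ 2 \<Rightarrow> 'k ^ 2 \<Rightarrow> 'k ^ 2) \<Rightarrow> bool" where
  "idempotent_free P \<longleftrightarrow> (\<forall>x. P x x = x \<longrightarrow> x = 0)"

lemma idempotent_free_iso: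
  assumes "algebra_iso (*s) P (*s) Q" "idempotent_free P"
  shows "idempotent_free (Q :: 'k::field ^ 2 \<Rightarrow> _)"
proof -
  obtain f :: "'k ^ 2 \<Rightarrow> 'k ^ 2" where f: "Vector_Spaces.linear (*s) (*s) f" "bij f"
    "\<And>x y. f (P x y) = Q (f x) (f y)"
    using assms(1) unfolding algebra_iso_def by blast
  interpret f: Vector_Spaces.linear "(*s)" "(*s)" f by (fact f(1))
  have inj: "f x = f y \<longleftrightarrow> x = y" for x y using f(2) by (simp add: bij_is_inj inj_eq)
  have surj: "\<exists>x. y = f x" for y using f(2) by (simp add: bij_is_surj surjD)
  show ?thesis
    using assms(2) f(3) inj f.zero surj unfolding idempotent_free_def by metis
qed

lemma classified_antisymmetric:
  assumes "a \<noteq> 0 \<or> \<alpha> \<noteq> 0"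
  shows "classified K W (tab 0 0 a \<alpha> (-a) (-\<alpha>) 0 0)"
proof -
  \<comment> \<open>The product of \<open>x\<close> and \<open>y\<close> is the determinant of
    \<open>x\<close>, \<open>y\<close> times \<open>vec2 a \<alpha>\<close>. The vector
    \<open>u\<close> is chosen to have determinant 1 with \<open>vec2 a \<alpha>\<close>.\<close>
  define u where "u = (if \<alpha> = 0 then vec2 0 (-1/a) else vec2 (1/\<alpha>) 0)"
  have "algebra_iso (*s) (tab 0 0 a \<alpha> (-a) (-\<alpha>) 0 0) (*s) (tab 0 0 0 1 0 (-1) 0 0)"
    by (rule algebra_iso_tab_basis[of _ u "vec2 a \<alpha>"])
      (use assms in \<open>auto simp: u_def bilinear_tab vec2_eq_iff tab_nth\<close>)
  then show ?thesis
    by (rule classified_iso) (simp add: classified_calg[of _ _ _ _ _ _ _ _ C06] calg_tab del: calg.simps)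
qed

lemma classified_two_nil:
  fixes a b \<alpha> \<beta> :: "'k::field_char_0"
  assumes C: "conservative (*s) (tab 0 0 a \<alpha> b \<beta> 0 0)"
    and i: "idempotent_free (tab 0 0 a \<alpha> b \<beta> 0 0)"
    and nz: "\<exists>x y. tab 0 0 a \<alpha> b \<beta> 0 0 x y \<noteq> 0"
  shows "classified K W (tab 0 0 a \<alpha> b \<beta> 0 0)"
proof -
  have s: "a + b = 0 \<or> \<alpha> + \<beta> = 0"
  proof (rule ccontr)
    assume "\<not> ?thesis"
    then have s: "a + b \<noteq> 0" "\<alpha> + \<beta> \<noteq> 0" by auto
    \<comment> \<open>Here \<open>x x = x_1 * x_2 * (a + b, \<alpha> + \<beta>)\<close>, and these
      coordinates make the scalar \<open>x_1 * x_2\<close> fit.\<close>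
    let ?x = "vec2 (1 / (\<alpha> + \<beta>)) (1 / (a + b))"
    have "tab 0 0 a \<alpha> b \<beta> 0 0 ?x ?x = ?x"
      using s by (simp add: vec2_eq_iff tab_nth divide_simps)
    then have "?x = 0" using i unfolding idempotent_free_def by blast
    then show False using s by (simp add: vec2_eq_iff)
  qed
  have main: "classified K W (tab 0 0 a \<alpha> b (-\<alpha>) 0 0)"
    if C: "conservative (*s) (tab 0 0 a \<alpha> b (-\<alpha>) 0 0)" and nz: "a \<noteq> 0 \<or> b \<noteq> 0 \<or> \<alpha> \<noteq> 0" for a b \<alpha> :: 'k
  proof (cases "a + b = 0")
    case True
    then have "b = - a" by (simp add: add_eq_0_iff)
    then show ?thesis using classified_antisymmetric nz by auto
  next
    case False
    with conservative_two_nil[OF C] have al: "\<alpha> = 0" by blast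
    have "1 - b / (a + b) = a / (a + b)" using False by (simp add: field_simps)
    then have "algebra_iso (*s) (tab 0 0 a \<alpha> b (-\<alpha>) 0 0) (*s) (calg (C05 (b / (a + b))))"
      using algebra_iso_scale_basis[of 1 "1 / (a + b)" 0 0 a 0 b 0 0 0] False al
        by (simp add: calg_tab del: calg.simps)
    then show ?thesis unfolding classified_def by (intro disjI1 exI[of _ "C05 (b / (a + b))"]) simp
  qed
  have nz': "a \<noteq> 0 \<or> b \<noteq> 0 \<or> \<alpha> \<noteq> 0 \<or> \<beta> \<noteq> 0"
    using nz by (auto simp: vec2_eq_iff tab_nth)
  from s show ?thesis
  proof
    assume "\<alpha> + \<beta> = 0"
    then have "\<beta> = - \<alpha>" by (simp add: add_eq_0_iff)
    then show ?thesis using main[of a \<alpha> b] C nz' by auto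
  next
    assume "a + b = 0"
    then have b: "a = - b" by (simp add: eq_neg_iff_add_eq_0)
    have "conservative (*s) (tab 0 0 \<beta> b \<alpha> (-b) 0 0)"
      using conservative_iso[OF algebra_iso_swap C] by (simp add: b)
    then have "classified K W (tab 0 0 \<beta> b \<alpha> (-b) 0 0)"
      using main[of \<beta> b \<alpha>] nz' b by auto
    then show ?thesis unfolding b by (rule classified_swap)
  qed
qed

lemma classified_one_nil:
  fixes a p \<alpha> :: "'k::field_char_0"
  assumes C: "conservative (*s) (tab p 1 a \<alpha> (-a) (p - \<alpha>) 0 0)"
  shows "classified K W (tab p 1 a \<alpha> (-a) (p - \<alpha>) 0 0)"
proof -
  consider "a = 0" "p = 0" "\<alpha> = 0" | "a = 0" "p = 0" "\<alpha> \<noteq> 0" | "a = 0" "p \<noteq> 0" "\<alpha> = p"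
    | "a = 0" "p \<noteq> 0" "\<alpha> = 2 * p"
    using conservative_one_nil[OF C] by blast
  then show ?thesis
  proof cases
    case 1
    then show ?thesis
      by (intro classified_calg[of _ _ _ _ _ _ _ _ C04]) (simp_all add: calg_tab del: calg.simps)
  next
    case 2
    have "algebra_iso (*s) (tab p 1 a \<alpha> (-a) (p - \<alpha>) 0 0) (*s) (tab 0 1 0 1 0 (-1) 0 0)"
      using algebra_iso_scale_basis[of "1 / \<alpha>" "1 / \<alpha>^2" p 1 a \<alpha> "-a" "p - \<alpha>" 0 0] 2
        by (simp add: power2_eq_square)
    then show ?thesis
      by (rule classified_iso) (simp add: classified_calg[of _ _ _ _ _ _ _ _ C03] calg_tab del: calg.simps)
  next
    case 3
    have "algebra_iso (*s) (tab p 1 a \<alpha> (-a) (p - \<alpha>) 0 0) (*s) (tab 1 1 0 1 0 0 0 0)"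
      using algebra_iso_scale_basis[of "1 / p" "1 / p^2" p 1 a \<alpha> "-a" "p - \<alpha>" 0 0] 3
        by (simp add: power2_eq_square)
    then show ?thesis
      by (rule classified_iso) (simp add: classified_calg[of _ _ _ _ _ _ _ _ C01] calg_tab del: calg.simps)
  next
    case 4
    have "algebra_iso (*s) (tab p 1 a \<alpha> (-a) (p - \<alpha>) 0 0) (*s) (tab 1 1 0 2 0 (-1) 0 0)"
      using algebra_iso_scale_basis[of "1 / p" "1 / p^2" p 1 a \<alpha> "-a" "p - \<alpha>" 0 0] 4
        by (simp add: power2_eq_square)
    then show ?thesis
      by (rule classified_iso) (simp add: classified_calg[of _ _ _ _ _ _ _ _ C02] calg_tab del: calg.simps)
  qed
qed

lemma classified_nil:
  fixes p q a b \<alpha> \<beta> :: "'k::{alg_closed_field, field_char_0}"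
  assumes C: "conservative (*s) (tab p q a \<alpha> b \<beta> 0 0)"
    and i: "idempotent_free (tab p q a \<alpha> b \<beta> 0 0)"
    and nz: "\<exists>x y. tab p q a \<alpha> b \<beta> 0 0 x y \<noteq> 0"
  shows "classified K W (tab p q a \<alpha> b \<beta> 0 0)"
proof (cases "a + b = 0 \<and> \<alpha> + \<beta> = p \<and> q \<noteq> 0")
  case True
  then have s: "b = - a" "\<beta> = p - \<alpha>" "q \<noteq> 0"
    by (auto simp: add_eq_0_iff eq_diff_eq add.commute)
  have "algebra_iso (*s) (tab p q a \<alpha> b \<beta> 0 0) (*s) (tab p 1 (q * a) \<alpha> (- (q * a)) (p - \<alpha>) 0 0)"
    using algebra_iso_scale_basis[of 1 q p q a \<alpha> b \<beta> 0 0] s by simp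
  then show ?thesis using classified_iso conservative_iso[OF _ C] classified_one_nil by blast
next
  case False
  let ?P = "tab p q a \<alpha> b \<beta> 0 0"
  \<comment> \<open>A root \<open>m\<close> makes the square of \<open>e1 + m e2\<close> a multiple
    of that vector. The case already settled is the one in which \<open>e2\<close> is a triple zero
    and the polynomial is a nonzero constant.\<close>
  have "\<exists>m. q + (\<alpha> + \<beta> - p) * m + - (a + b) * m^2 = 0"
  proof (cases "q = 0")
    case True then show ?thesis by (intro exI[of _ 0]) simp
  next
    case False then show ?thesis using \<open>\<not> (_ \<and> _)\<close>
      by (intro quadratic_root) (auto simp: neg_eq_iff_add_eq_0)
  qed
  then obtain m where m: "q + (\<alpha> + \<beta> - p) * m + - (a + b) * m^2 = 0" by blast
  define r where "r = p + (a + b) * m"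
  have "q + (\<alpha> + \<beta>) * m = r * m" using m unfolding r_def by algebra
  then have sq: "?P (vec2 1 m) (vec2 1 m) = r *s vec2 1 m"
    by (simp add: vec2_eq_iff tab_nth r_def algebra_simps)
  have "r = 0"
  proof (rule ccontr)
    assume r: "r \<noteq> 0"
    have "?P ((1/r) *s vec2 1 m) ((1/r) *s vec2 1 m) = (1/r) *s vec2 1 m"
      unfolding tab_scale sq using r by simp
    then have "(1/r) *s vec2 1 m = 0" using i unfolding idempotent_free_def by blast
    then show False using r by (simp add: vec2_eq_iff)
  qed
  then obtain b1 b2 c1 c2 where iso: "algebra_iso (*s) ?P (*s) (tab 0 0 b1 b2 c1 c2 0 0)"
    using algebra_iso_basis[of ?P "vec2 1 m" e2 0 0 0 0] sq
    by (auto simp: bilinear_tab e_nth vec2_eq_iff tab_nth)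
  have "\<exists>x y. tab 0 0 b1 b2 c1 c2 0 0 x y \<noteq> 0"
    by (rule nonzero_mult_iso[OF iso nz])
  then show ?thesis
    using classified_iso[OF iso classified_two_nil] conservative_iso[OF iso C] idempotent_free_iso[OF iso i] by blast
qed

section \<open>The zero of the cubic form and the full case distinction\<close>

text \<open>The cubic polynomial below is \<open>x \<and> x\<^sup>2\<close> at
  \<open>x = vec2 1 t\<close>; for \<open>d1 = 0\<close> the point at infinity \<open>e2\<close> is
  a zero.\<close>

lemma exists_eigen:
  fixes P :: "'k::alg_closed_field ^ 2 \<Rightarrow> _"
  assumes P: "P = tab a1 a2 b1 b2 c1 c2 d1 d2"
  shows "\<exists>v r. v \<noteq> 0 \<and> P v v = r *s v"
proof (cases "d1 = 0")
  case True
  then show ?thesis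
    by (intro exI[of _ e2] exI[of _ d2]) (simp add: P e_nth vec2_eq_iff tab_nth)
next
  case False
  then have "- d1 \<noteq> 0" by simp
  from cubic_root[OF this] obtain t where t: "a2 + (b2 + c2 - a1) * t + (d2 - b1 - c1) * t^2 + - d1 * t^3 = 0"
    by blast
  show ?thesis
  proof (intro exI conjI)
    show "vec2 1 t \<noteq> 0" by (simp add: vec2_eq_iff)
    have "a2 + (b2 + c2) * t + d2 * t * t = (a1 + (b1 + c1) * t + d1 * t * t) * t"
      using t by algebra
    then show "P (vec2 1 t) (vec2 1 t) = (a1 + (b1 + c1) * t + d1 * t * t) *s vec2 1 t"
      by (simp add: P vec2_eq_iff tab_nth algebra_simps)
  qed
qed

lemma classified_tab:
  fixes P :: "'k::{alg_closed_field, field_char_0} ^ 2 \<Rightarrow> _"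
  assumes W: "adapted_reps W" and K: "inversion_reps K"
    and P: "P = tab a1 a2 b1 b2 c1 c2 d1 d2" and C: "conservative (*s) P" and nz: "\<exists>x y. P x y \<noteq> 0"
  shows "classified K W P"
proof (cases "many_idempotents P")
  case True
  then show ?thesis using classified_many[OF W K C _ P] by blast
next
  case many: False
  show ?thesis
  proof (cases "idempotent_free P")
    case False
    then obtain x where x: "P x x = x" "x \<noteq> 0" unfolding idempotent_free_def by blast
    obtain u :: "'k ^ 2" where u: "x$1 * u$2 \<noteq> x$2 * u$1" using exists_complement[OF x(2)] by blast
    obtain d1' d2' where "P u u = d1' *s x + d2' *s u" using exists_comb[OF u] by blast
    then obtain b1' b2' c1' c2' where iso: "algebra_iso (*s) P (*s) (tab 1 0 b1' b2' c1' c2' d1' d2')"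
      using algebra_iso_basis[of P x u 1 0 d1' d2'] u x by (auto simp: P bilinear_tab)
    show ?thesis
      using classified_iso[OF iso classified_idempotent] conservative_iso[OF iso C]
        many_idempotents_iso[OF algebra_iso_sym[OF iso]] many by blast
  next
    case i: True
    obtain v r where v: "v \<noteq> 0" "P v v = r *s v" using exists_eigen[OF P] by blast
    have "r = 0"
    proof (rule ccontr)
      assume r: "r \<noteq> 0"
      have "P ((1/r) *s v) ((1/r) *s v) = (1/r) *s v"
        using v(2) r by (simp add: P tab_scale)
      then have "(1/r) *s v = 0" using i unfolding idempotent_free_def by blast
      then show False using r v by simp
    qed
    obtain u :: "'k ^ 2" where u: "v$1 * u$2 \<noteq> v$2 * u$1" using exists_complement[OF v(1)] by blast
    obtain p q where "P u u = p *s v + q *s u" using exists_comb[OF u] by blast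
    then obtain b1' b2' c1' c2' where iso: "algebra_iso (*s) P (*s) (tab q p b1' b2' c1' c2' 0 0)"
      using algebra_iso_basis[of P u v q p 0 0] u v \<open>r = 0\<close>
        by (auto simp: P bilinear_tab mult.commute add.commute)
    have "\<exists>x y. tab q p b1' b2' c1' c2' 0 0 x y \<noteq> 0"
      by (rule nonzero_mult_iso[OF iso nz])
    then show ?thesis
      using classified_iso[OF iso classified_nil] conservative_iso[OF iso C] idempotent_free_iso[OF iso i] by blast
  qed
qed

lemma classification_exists:
  fixes s :: "'k::{alg_closed_field, field_char_0} \<Rightarrow> 'v::ab_group_add \<Rightarrow> 'v"
  assumes W: "adapted_reps W" and K: "inversion_reps K"
    and A: "algebra_on s P" "vector_space.dim s (UNIV :: 'v set) = 2" "conservative s P"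
      "\<exists>x y. P x y \<noteq> 0"
  shows "(\<exists>l. listed K W l \<and> algebra_iso s P (*s) (calg l)) \<or> algebra_iso s P (*s) alg_omitted"
proof -
  obtain a1 a2 b1 b2 c1 c2 d1 d2 where iso: "algebra_iso s P (*s) (tab a1 a2 b1 b2 c1 c2 d1 d2)"
    using exists_table[OF A(1,2)] by (elim exE)
  have "\<exists>x y. tab a1 a2 b1 b2 c1 c2 d1 d2 x y \<noteq> 0"
    by (rule nonzero_mult_iso[OF iso A(4)])
  then have "classified K W (tab a1 a2 b1 b2 c1 c2 d1 d2)"
    by (intro classified_tab[OF W K refl conservative_iso[OF iso A(3)]])
  then show ?thesis unfolding classified_def using algebra_iso_trans[OF iso] by blast
qed

section \<open>Isomorphism invariants\<close>

text \<open>
  The pairs of eigenvalues of \<open>L\<^sub>x\<close> and \<open>R\<^sub>x\<close> on the quotient by the line of a nonzero idempotent \<open>x\<close>.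
  For \<open>x = e\<^sub>1, e\<^sub>2\<close> in an algebra with two idempotents these are the paper's \<open>\<C>\<^sub>1\<close> and \<open>\<C>\<^sub>2\<close>.
\<close>

definition idempotent_types :: "('k::field ^ 2 \<Rightarrow> 'k ^ 2 \<Rightarrow> 'k ^ 2) \<Rightarrow> ('k \<times> 'k) set" where
  "idempotent_types P = {(l, m). \<exists>x w a b. x \<noteq> 0 \<and> P x x = x \<and> (\<forall>c. w \<noteq> c *s x) \<and>
     P x w = a *s x + l *s w \<and> P w x = b *s x + m *s w}"

definition two_nil :: "('k::field ^ 2 \<Rightarrow> 'k ^ 2 \<Rightarrow> 'k ^ 2) \<Rightarrow> bool" where
  "two_nil P \<longleftrightarrow> (\<exists>x y. x \<noteq> 0 \<and> (\<forall>c. y \<noteq> c *s x) \<and> P x x = 0 \<and> P y y = 0)"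

text \<open>The algebras \<open>C05 \<alpha>\<close> have no nonzero idempotents and all share one
  kind, so their parameter needs an invariant of its own. For \<open>v = e1\<close>,
  \<open>w = e2\<close> it is read off as \<open>m = \<alpha>\<close>.\<close>

definition nil_types :: "('k::field ^ 2 \<Rightarrow> 'k ^ 2 \<Rightarrow> 'k ^ 2) \<Rightarrow> 'k set" where
  "nil_types P = {m. \<exists>v w. v \<noteq> 0 \<and> P v v = 0 \<and> P w w = 0 \<and> P v w = (1 - m) *s v \<and> P w v = m *s v}"

text \<open>
  The values are chosen so that \<open>C01\<close>, ..., \<open>C06\<close> have kinds 1, ..., 6.  Among algebras with
  idempotents, kind only has to separate those with the same idempotent types, see \<open>kind_calg\<close>.
\<close>

definition kind :: "('k::field ^ 2 \<Rightarrow> 'k ^ 2 \<Rightarrow> 'k ^ 2) \<Rightarrow> nat" where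
  "kind P = (if many_idempotents P then 0 else if \<forall>x. P x x = 0 then 6 else if two_nil P then 5
     else if \<forall>x y. P x y = P y x then 4 else if \<exists>x. x \<noteq> 0 \<and> (\<forall>y. P x y = 0) then 1
     else if \<forall>x. P (P x x) (P x x) = 0 then 3 else 2)"

lemma invariants_iso:
  fixes P Q :: "'k::field ^ 2 \<Rightarrow> 'k ^ 2 \<Rightarrow> 'k ^ 2"
  assumes "algebra_iso (*s) P (*s) Q"
  shows "idempotent_types P = idempotent_types Q" "nil_types P = nil_types Q" "kind P = kind Q"
proof -
  obtain f :: "'k ^ 2 \<Rightarrow> 'k ^ 2" where f: "Vector_Spaces.linear (*s) (*s) f" "bij f"
    "\<And>x y. f (P x y) = Q (f x) (f y)"
    using assms unfolding algebra_iso_def by blast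
  interpret f: Vector_Spaces.linear "(*s)" "(*s)" f by (fact f(1))
  have inj: "f x = f y \<longleftrightarrow> x = y" for x y using f(2) by (simp add: bij_is_inj inj_eq)
  have f0: "f x = 0 \<longleftrightarrow> x = 0" for x using inj[of x 0] by simp
  \<comment> \<open>By surjectivity, quantifiers over the codomain become quantifiers over the
    domain; \<open>h\<close> then pulls \<open>f\<close> out of every equation. The substitutions
    below touch the quantifiers over vectors and leave those over scalars alone.\<close>
  have all: "(\<forall>y. R y) \<longleftrightarrow> (\<forall>x. R (f x))" and ex: "(\<exists>y. R y) \<longleftrightarrow> (\<exists>x. R (f x))" for R
    using f(2) by (metis bij_is_surj surjD)+
  note h = f(3)[symmetric] f.scale[symmetric] f.add[symmetric] inj f0
  have "idempotent_types Q = {(l, m). \<exists>x w a b. f x \<noteq> 0 \<and> Q (f x) (f x) = f x \<and> (\<forall>c. f w \<noteq> c *s f x) \<and>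
     Q (f x) (f w) = a *s f x + l *s f w \<and> Q (f w) (f x) = b *s f x + m *s f w}"
    unfolding idempotent_types_def by (subst ex, subst (2) ex) (rule refl)
  then show "idempotent_types P = idempotent_types Q" unfolding h idempotent_types_def[of P] by simp
  have "nil_types Q = {m. \<exists>v w. f v \<noteq> 0 \<and> Q (f v) (f v) = 0 \<and> Q (f w) (f w) = 0 \<and>
      Q (f v) (f w) = (1 - m) *s f v \<and> Q (f w) (f v) = m *s f v}"
    unfolding nil_types_def by (subst ex, subst (2) ex) (rule refl)
  then show "nil_types P = nil_types Q" unfolding h nil_types_def[of P] by simp
  have "many_idempotents Q \<longleftrightarrow> (\<exists>x y. f x \<noteq> 0 \<and> f y \<noteq> 0 \<and> f x \<noteq> f y \<and> Q (f x) (f x) = f x \<and> Q (f y) (f y) = f y)"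
    unfolding many_idempotents_def by (subst ex, subst (2) ex) (rule refl)
  then have 1: "many_idempotents Q = many_idempotents P" unfolding h many_idempotents_def[of P] .
  have "two_nil Q \<longleftrightarrow> (\<exists>x y. f x \<noteq> 0 \<and> (\<forall>c. f y \<noteq> c *s f x) \<and> Q (f x) (f x) = 0 \<and> Q (f y) (f y) = 0)"
    unfolding two_nil_def by (subst ex, subst (2) ex) (rule refl)
  then have 2: "two_nil Q = two_nil P" unfolding h two_nil_def[of P] .
  have 3: "(\<forall>x. Q x x = 0) \<longleftrightarrow> (\<forall>x. P x x = 0)"
    by (subst all) (simp add: h)
  have 4: "(\<forall>x y. Q x y = Q y x) \<longleftrightarrow> (\<forall>x y. P x y = P y x)"
    by (subst all, subst (2) all) (simp add: h)
  have 5: "(\<exists>x. x \<noteq> 0 \<and> (\<forall>y. Q x y = 0)) \<longleftrightarrow> (\<exists>x. x \<noteq> 0 \<and> (\<forall>y. P x y = 0))"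
    by (subst ex, subst all) (simp add: h)
  have 6: "(\<forall>x. Q (Q x x) (Q x x) = 0) \<longleftrightarrow> (\<forall>x. P (P x x) (P x x) = 0)"
    by (subst all) (simp add: h)
  show "kind P = kind Q" unfolding kind_def 1 2 3 4 5 6 ..
qed

lemma not_scale_iff: "x \<noteq> 0 \<Longrightarrow> (\<forall>c. w \<noteq> c *s x) \<longleftrightarrow> x$1 * w$2 \<noteq> x$2 * (w :: 'k::field ^ 2)$1"
  using parallel_scale[of x w] by auto

text \<open>An idempotent \<open>x\<close> contributes the eigenvalue 1, so the other eigenvalue is the trace minus 1.\<close>

lemma idempotent_types_tab:
  "idempotent_types (tab a1 a2 b1 b2 c1 c2 d1 d2) =
   {(x$1*(a1+b2) + x$2*(c1+d2) - 1, x$1*(a1+c2) + x$2*(b1+d2) - 1) | x.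
      x \<noteq> 0 \<and> tab a1 a2 b1 b2 c1 c2 d1 d2 x x = (x :: 'k::field ^ 2)}"
  (is "_ = ?T")
proof -
  let ?P = "tab a1 a2 b1 b2 c1 c2 d1 d2"
  have tr: "l = x$1*(a1+b2) + x$2*(c1+d2) - 1 \<and> m = x$1*(a1+c2) + x$2*(b1+d2) - 1"
    if x: "x \<noteq> 0" "?P x x = x" and w: "x$1 * w$2 \<noteq> x$2 * w$1"
      and e: "?P x w = a *s x + l *s w" "?P w x = b *s x + m *s w" for x w :: "'k^2" and a b l m
  proof -
    have D: "x$1 * w$2 - x$2 * w$1 \<noteq> 0" using w by simp
    have x1: "?P x x $ 1 = x $ 1" "?P x x $ 2 = x $ 2"
      and e1: "?P x w $ 1 = a * x$1 + l * w$1" "?P x w $ 2 = a * x$2 + l * w$2"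
      and e2: "?P w x $ 1 = b * x$1 + m * w$1" "?P w x $ 2 = b * x$2 + m * w$2"
      using x(2) e by simp_all
    \<comment> \<open>This is \<open>tr A * det(x, w) = det(A x, w) + det(x, A w)\<close> for
      \<open>A = L_x\<close>; the second computation is the same for right multiplication.\<close>
    have "(x$1*(a1+b2) + x$2*(c1+d2)) * (x$1 * w$2 - x$2 * w$1) =
        (?P x x $ 1 * w$2 - ?P x x $ 2 * w$1) + (x$1 * ?P x w $ 2 - x$2 * ?P x w $ 1)"
      unfolding tab_nth by (simp add: algebra_simps)
    also have "\<dots> = (1 + l) * (x$1 * w$2 - x$2 * w$1)" unfolding x1 e1 by (simp add: algebra_simps)
    finally have l: "x$1*(a1+b2) + x$2*(c1+d2) = 1 + l" using D by simp
    have "(x$1*(a1+c2) + x$2*(b1+d2)) * (x$1 * w$2 - x$2 * w$1) =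
        (?P x x $ 1 * w$2 - ?P x x $ 2 * w$1) + (x$1 * ?P w x $ 2 - x$2 * ?P w x $ 1)"
      unfolding tab_nth by (simp add: algebra_simps)
    also have "\<dots> = (1 + m) * (x$1 * w$2 - x$2 * w$1)" unfolding x1 e2 by (simp add: algebra_simps)
    finally have m: "x$1*(a1+c2) + x$2*(b1+d2) = 1 + m" using D by simp
    show ?thesis unfolding l m by simp
  qed
  show ?thesis
  proof (intro equalityI subsetI)
    fix p assume "p \<in> idempotent_types ?P"
    then obtain l m x w a b where p: "p = (l, m)" and x: "x \<noteq> 0" "?P x x = x"
      and w: "\<forall>c. w \<noteq> c *s x" and e: "?P x w = a *s x + l *s w" "?P w x = b *s x + m *s w"
      unfolding idempotent_types_def by blast
    show "p \<in> ?T" using tr[OF x _ e] w x unfolding p not_scale_iff[OF x(1)] by blast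
  next
    fix p assume "p \<in> ?T"
    then obtain x where x: "x \<noteq> 0" "?P x x = x"
      and p: "p = (x$1*(a1+b2) + x$2*(c1+d2) - 1, x$1*(a1+c2) + x$2*(b1+d2) - 1)" by blast
    obtain w :: "'k^2" where w: "x$1 * w$2 \<noteq> x$2 * w$1" using exists_complement[OF x(1)] by blast
    obtain a l where l: "?P x w = a *s x + l *s w" using exists_comb[OF w] by blast
    obtain b m where m: "?P w x = b *s x + m *s w" using exists_comb[OF w] by blast
    have "p = (l, m)" using tr[OF x w l m] p by simp
    then show "p \<in> idempotent_types ?P"
      using x w l m unfolding idempotent_types_def not_scale_iff[OF x(1), symmetric] by blast
  qed
qed

section \<open>Idempotents, their types and the kinds of the listed algebras\<close>

lemma idempotent_types_calg_C01_C06: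
  "idempotent_types (calg C01 :: 'k::field_char_0^2 \<Rightarrow> _) = {}"
  "idempotent_types (calg C02 :: 'k^2 \<Rightarrow> _) = {}"
  "idempotent_types (calg C03 :: 'k^2 \<Rightarrow> _) = {}"
  "idempotent_types (calg C04 :: 'k^2 \<Rightarrow> _) = {}"
  "idempotent_types (calg (C05 a) :: 'k^2 \<Rightarrow> _) = {}"
  "idempotent_types (calg C06 :: 'k^2 \<Rightarrow> _) = {}"
  unfolding calg_tab idempotent_types_tab by (auto simp: vec2_eq_iff tab_nth)

lemma calg_idempotents:
  fixes x :: "'k::field_char_0 ^ 2"
  shows "calg C01 x x = x \<longleftrightarrow> x = 0" "calg C02 x x = x \<longleftrightarrow> x = 0" "calg C03 x x = x \<longleftrightarrow> x = 0"
    "calg C04 x x = x \<longleftrightarrow> x = 0" "calg (C05 a) x x = x \<longleftrightarrow> x = 0" "calg C06 x x = x \<longleftrightarrow> x = 0"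
    "calg C07 x x = x \<longleftrightarrow> x = 0 \<or> x = e2" "calg C08 x x = x \<longleftrightarrow> x = 0 \<or> x = e1" "calg C09 x x = x \<longleftrightarrow> x = 0 \<or> x = e1"
    "a + b \<noteq> 1 \<Longrightarrow> calg (C10 a b) x x = x \<longleftrightarrow> x = 0 \<or> x = e1"
    "calg (C17 a) x x = x \<longleftrightarrow> x = 0 \<or> x$1 + x$2 = 1"
proof -
  show "a + b \<noteq> 1 \<Longrightarrow> calg (C10 a b) x x = x \<longleftrightarrow> x = 0 \<or> x = e1"
    unfolding calg_tab vec2_eq_iff tab_nth by (auto simp: e_nth simp flip: distrib_left)
  have "calg (C17 a) x x = (x$1 + x$2) *s x"
    unfolding calg_tab vec2_eq_iff tab_nth by (simp add: algebra_simps)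
  then show "calg (C17 a) x x = x \<longleftrightarrow> x = 0 \<or> x$1 + x$2 = 1" by (auto simp: vec2_eq_iff)
qed (auto simp: calg_tab vec2_eq_iff tab_nth e_nth simp del: calg.simps)

lemma E_idempotents:
  fixes x :: "'k::field_char_0 ^ 2"
  assumes "x$1 \<noteq> 0" "x$2 \<noteq> 0"
  shows "tab 1 0 \<alpha> \<beta> \<gamma> \<delta> 0 1 x x = x \<longleftrightarrow> x$1 + (\<alpha> + \<gamma>) * x$2 = 1 \<and> (\<beta> + \<delta>) * x$1 + x$2 = 1"
proof -
  have "tab 1 0 \<alpha> \<beta> \<gamma> \<delta> 0 1 x x = x \<longleftrightarrow>
      x$1 * (x$1 + (\<alpha> + \<gamma>) * x$2) = x$1 * 1 \<and> x$2 * ((\<beta> + \<delta>) * x$1 + x$2) = x$2 * 1"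
    unfolding vec2_eq_iff tab_nth by (simp add: algebra_simps)
  then show ?thesis using assms by simp
qed

text \<open>Off the axes, idempotents are the common points of two lines. Cramer's rule shows that
  under the hypotheses these lines do not meet there.\<close>

lemma E_idempotents_two:
  fixes x :: "'k::field_char_0 ^ 2"
  assumes 1: "\<alpha> + \<gamma> \<noteq> 1 \<or> \<beta> + \<delta> \<noteq> 1" and 2: "\<alpha> + \<gamma> = 1 \<or> \<beta> + \<delta> = 1 \<or> (\<alpha> + \<gamma>) * (\<beta> + \<delta>) = 1"
  shows "x \<noteq> 0 \<and> tab 1 0 \<alpha> \<beta> \<gamma> \<delta> 0 1 x x = x \<longleftrightarrow> x = e1 \<or> x = e2"
proof (cases "x$1 = 0 \<or> x$2 = 0")
  case True
  then show ?thesis by (auto simp: vec2_eq_iff tab_nth e_nth)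
next
  case False
  have "\<not> (x$1 + (\<alpha> + \<gamma>) * x$2 = 1 \<and> (\<beta> + \<delta>) * x$1 + x$2 = 1)"
  proof
    assume *: "x$1 + (\<alpha> + \<gamma>) * x$2 = 1 \<and> (\<beta> + \<delta>) * x$1 + x$2 = 1"
    define s r where "s = \<alpha> + \<gamma>" and "r = \<beta> + \<delta>"
    have "x$1 * (s * r - 1) = s - 1" "x$2 * (s * r - 1) = r - 1"
      using * unfolding s_def r_def by algebra+
    then show False using 1 2 False unfolding s_def[symmetric] r_def[symmetric] by auto
  qed
  then show ?thesis using False E_idempotents[of x \<alpha> \<beta> \<gamma> \<delta>] by (auto simp: e_nth)
qed

lemma idempotent_types_tab_image:
  assumes "\<And>x. x \<noteq> 0 \<and> tab a1 a2 b1 b2 c1 c2 d1 d2 x x = (x :: 'k::field ^ 2) \<longleftrightarrow> x \<in> S"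
  shows "idempotent_types (tab a1 a2 b1 b2 c1 c2 d1 d2) =
    (\<lambda>x. (x$1*(a1+b2) + x$2*(c1+d2) - 1, x$1*(a1+c2) + x$2*(b1+d2) - 1)) ` S"
  unfolding idempotent_types_tab assms by blast

lemma idempotent_types_E_two:
  fixes \<alpha> \<beta> \<gamma> \<delta> :: "'k::field_char_0"
  assumes "\<alpha> + \<gamma> \<noteq> 1 \<or> \<beta> + \<delta> \<noteq> 1" "\<alpha> + \<gamma> = 1 \<or> \<beta> + \<delta> = 1 \<or> (\<alpha> + \<gamma>) * (\<beta> + \<delta>) = 1"
  shows "idempotent_types (tab 1 0 \<alpha> \<beta> \<gamma> \<delta> 0 1) = {(\<beta>, \<delta>), (\<gamma>, \<alpha>)}"
  by (subst idempotent_types_tab_image[where S = "{e1, e2}"]) (use E_idempotents_two[OF assms] in \<open>auto simp: e_nth\<close>)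

text \<open>The third type is \<open>calC3 (0, a, b, 0)\<close>, contributed by the idempotent
  \<open>?w\<close> off the axes.\<close>

lemma idempotent_types_C11:
  fixes a b :: "'k::field_char_0"
  assumes "a \<noteq> 1" "b \<noteq> 1" "a * b \<noteq> 1"
  shows "idempotent_types (calg (C11 a b)) = {(a, 0), (b, 0), (1, - ((a - 1) * (b - 1)) / (a * b - 1))}"
proof -
  define D where "D = a * b - 1"
  have D: "D \<noteq> 0" using assms by (simp add: D_def)
  let ?w = "vec2 ((b - 1) / D) ((a - 1) / D)"
  have "x \<noteq> 0 \<and> tab 1 0 0 a b 0 0 1 x x = x \<longleftrightarrow> x = e1 \<or> x = e2 \<or> x = ?w" for x
  proof (cases "x$1 = 0 \<or> x$2 = 0")
    case True
    then show ?thesis using assms D by (auto simp: vec2_eq_iff tab_nth e_nth)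
  next
    case False
    have "x = ?w \<longleftrightarrow> x$1 * D = b - 1 \<and> x$2 * D = a - 1" using D
      by (auto simp: vec2_eq_iff eq_divide_eq)
    also have "\<dots> \<longleftrightarrow> x$1 + b * x$2 = 1 \<and> a * x$1 + x$2 = 1"
    proof
      assume *: "x$1 * D = b - 1 \<and> x$2 * D = a - 1"
      then have "D * (x$1 + b * x$2) = b - 1 + b * (a - 1)" "D * (a * x$1 + x$2) = a * (b - 1) + (a - 1)"
        by algebra+
      then have "D * (x$1 + b * x$2) = D * 1" "D * (a * x$1 + x$2) = D * 1"
        by (simp_all add: D_def algebra_simps)
      then show "x$1 + b * x$2 = 1 \<and> a * x$1 + x$2 = 1" using D by simp
    next
      assume "x$1 + b * x$2 = 1 \<and> a * x$1 + x$2 = 1"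
      then show "x$1 * D = b - 1 \<and> x$2 * D = a - 1" unfolding D_def by algebra
    qed
    finally show ?thesis using False E_idempotents[of x 0 a b 0] by (auto simp: e_nth)
  qed
  note i = this
  have "(b - 1) / D * (1 + a) + (a - 1) / D * (b + 1) - 1 = 1"
    "(b - 1) / D + (a - 1) / D - 1 = - ((a - 1) * (b - 1)) / D"
    using D by (simp_all add: field_simps) (simp_all add: D_def algebra_simps)
  then show ?thesis
    unfolding calg_tab
      by (subst idempotent_types_tab_image[where S = "{e1, e2, ?w}"]) (use i in \<open>simp_all add: e_nth D_def\<close>)
qed

lemma idempotent_types_calg:
  "idempotent_types (calg C07 :: 'k::field_char_0^2 \<Rightarrow> _) = {(1, 0)}"
  "idempotent_types (calg C08 :: 'k^2 \<Rightarrow> _) = {(0, 0)}"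
  "idempotent_types (calg C09 :: 'k^2 \<Rightarrow> _) = {(1, -1)}"
  "a + b \<noteq> 1 \<Longrightarrow> idempotent_types (calg (C10 a b) :: 'k^2 \<Rightarrow> _) = {(a, b)}"
  "a \<noteq> 0 \<Longrightarrow> idempotent_types (calg (C12 a) :: 'k^2 \<Rightarrow> _) = {(1, a), (1, 0)}"
  "a \<noteq> 1 \<Longrightarrow> idempotent_types (calg (C13 a) :: 'k^2 \<Rightarrow> _) = {(a, 0), (1, 0)}"
  "a \<noteq> 0 \<Longrightarrow> a \<noteq> 1 \<Longrightarrow> idempotent_types (calg (C14 a) :: 'k^2 \<Rightarrow> _) = {(1, (1 - a) / a), (a, 0)}"
  "a \<noteq> 0 \<Longrightarrow> a \<noteq> 1 \<Longrightarrow> idempotent_types (calg (C15 a) :: 'k^2 \<Rightarrow> _) = {(1 / a, 0), (1, a - 1)}"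
  "idempotent_types (calg C16 :: 'k^2 \<Rightarrow> _) = {(0, -1)}"
  "idempotent_types (calg (C17 a) :: 'k^2 \<Rightarrow> _) = {(a, 1 - a)}"
proof -
  have e: "(e1 :: 'k^2) \<noteq> 0" "(e2 :: 'k^2) \<noteq> 0" by (simp_all add: vec2_eq_iff e_nth)
  note i = calg_idempotents[unfolded calg_tab]
  have ie: "x \<noteq> 0 \<and> (x = 0 \<or> x = e1) \<longleftrightarrow> x = e1" "x \<noteq> 0 \<and> (x = 0 \<or> x = e2) \<longleftrightarrow> x = e2" for x :: "'k^2"
    using e by auto
  show "idempotent_types (calg C07 :: 'k^2 \<Rightarrow> _) = {(1, 0)}" "idempotent_types (calg C08 :: 'k^2 \<Rightarrow> _) = {(0, 0)}"
    "idempotent_types (calg C09 :: 'k^2 \<Rightarrow> _) = {(1, -1)}"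
    "a + b \<noteq> 1 \<Longrightarrow> idempotent_types (calg (C10 a b) :: 'k^2 \<Rightarrow> _) = {(a, b)}"
    unfolding calg_tab idempotent_types_tab by (simp_all add: i ie e_nth)
  show "idempotent_types (calg (C17 a) :: 'k^2 \<Rightarrow> _) = {(a, 1 - a)}"
  proof -
    \<comment> \<open>\<open>C17\<close> has a whole line of idempotents, and they all have the same
      type.\<close>
    have "x \<noteq> 0 \<and> (x = 0 \<or> x$1 + x$2 = 1) \<longleftrightarrow> x$2 = 1 - x$1" for x :: "'k^2"
      by (auto simp: vec2_eq_iff eq_diff_eq add.commute)
    then have "idempotent_types (calg (C17 a) :: 'k^2 \<Rightarrow> _) = (\<lambda>x :: 'k^2. (x$1*(1+a) + x$2*(a+1) - 1,
        x$1*(1+(1-a)) + x$2*(1-a+1) - 1)) ` {x. x$2 = 1 - x$1}"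
      unfolding calg_tab by (intro idempotent_types_tab_image) (simp add: i)
    also have "\<dots> = (\<lambda>x. (a, 1 - a)) ` {x :: 'k^2. x$2 = 1 - x$1}"
    proof (intro image_cong refl)
      fix x :: "'k^2" assume "x \<in> {x. x$2 = 1 - x$1}"
      then have x: "x$2 = 1 - x$1" by simp
      show "(x$1*(1+a) + x$2*(a+1) - 1, x$1*(1+(1-a)) + x$2*(1-a+1) - 1) = (a, 1 - a)"
        unfolding x by (simp add: algebra_simps)
    qed
    also have "\<dots> = {(a, 1 - a)}" by (auto intro!: image_eqI[of _ _ e1] simp: e_nth)
    finally show ?thesis .
  qed
qed (unfold calg_tab, (subst idempotent_types_E_two; simp add: distrib_left)+)

lemma two_nil_iff:
  "two_nil P \<longleftrightarrow> (\<exists>x y :: 'k::field^2. x$1 * y$2 \<noteq> x$2 * y$1 \<and> P x x = 0 \<and> P y y = 0)"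
proof -
  have "x \<noteq> 0 \<and> (\<forall>c. y \<noteq> c *s x) \<longleftrightarrow> x$1 * y$2 \<noteq> x$2 * y$1" for x y :: "'k^2"
    using not_scale_iff[of x y] by auto
  then show ?thesis unfolding two_nil_def by (simp only: flip: conj_assoc)
qed

text \<open>Among algebras with idempotents, the coincidences of types left to \<open>kind\<close>
  are \<open>C07\<close> with \<open>C17 1\<close>, \<open>C08\<close> with \<open>C10 0 0\<close>,
  \<open>C09\<close> with \<open>C10 1 (-1)\<close>, and \<open>C16\<close> with
  \<open>C10 0 (-1)\<close>. For this it is enough that \<open>C07\<close> and \<open>C10\<close>
  avoid the kinds 0 and 5.\<close>

lemma kind_calg:
  "kind (calg C01 :: 'k::field_char_0^2 \<Rightarrow> _) = 1"
  "kind (calg C02 :: 'k^2 \<Rightarrow> _) = 2"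
  "kind (calg C03 :: 'k^2 \<Rightarrow> _) = 3"
  "kind (calg C04 :: 'k^2 \<Rightarrow> _) = 4"
  "kind (calg (C05 a) :: 'k^2 \<Rightarrow> _) = 5"
  "kind (calg C06 :: 'k^2 \<Rightarrow> _) = 6"
  "kind (calg C08 :: 'k^2 \<Rightarrow> _) = 5"
  "kind (calg C09 :: 'k^2 \<Rightarrow> _) = 5"
  "kind (calg C16 :: 'k^2 \<Rightarrow> _) = 0"
  "kind (calg (C17 a) :: 'k^2 \<Rightarrow> _) = 0"
  "kind (calg C07 :: 'k^2 \<Rightarrow> _) \<notin> {0, 5}"
  "a + b \<noteq> 1 \<Longrightarrow> kind (calg (C10 a b) :: 'k^2 \<Rightarrow> _) \<notin> {0, 5}"
proof -
  have m: "\<not> many_idempotents P" if "\<And>x. P x x = x \<longleftrightarrow> x = 0" for P :: "'k^2 \<Rightarrow> _"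
    using that unfolding many_idempotents_def by simp
  have m1: "\<not> many_idempotents P" if "\<And>x. P x x = x \<longleftrightarrow> x = 0 \<or> x = e" for e and P :: "'k^2 \<Rightarrow> _"
    using that unfolding many_idempotents_def by metis
  have mm: "many_idempotents P" if "P e1 e1 = e1" "P e2 e2 = e2" for P :: "'k^2 \<Rightarrow> _"
    using that unfolding many_idempotents_def
    by (intro exI[of _ e1] exI[of _ e2]) (simp add: vec2_eq_iff e_nth)
  have many: "\<not> many_idempotents (calg C01 :: 'k^2 \<Rightarrow> _)"
    "\<not> many_idempotents (calg C02 :: 'k^2 \<Rightarrow> _)"
    "\<not> many_idempotents (calg C03 :: 'k^2 \<Rightarrow> _)"
    "\<not> many_idempotents (calg C04 :: 'k^2 \<Rightarrow> _)"
    "\<not> many_idempotents (calg (C05 a) :: 'k^2 \<Rightarrow> _)"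
    "\<not> many_idempotents (calg C06 :: 'k^2 \<Rightarrow> _)"
    by (intro m calg_idempotents)+
  have many1: "\<not> many_idempotents (calg C07 :: 'k^2 \<Rightarrow> _)" "\<not> many_idempotents (calg C08 :: 'k^2 \<Rightarrow> _)"
    "\<not> many_idempotents (calg C09 :: 'k^2 \<Rightarrow> _)"
    "a + b \<noteq> 1 \<Longrightarrow> \<not> many_idempotents (calg (C10 a b) :: 'k^2 \<Rightarrow> _)"
    using m1[of "calg C07" e2] m1[of "calg C08" e1] m1[of "calg C09" e1] m1[of "calg (C10 a b)" e1]
    by (simp_all only: calg_idempotents simp_thms)
  note many = many many1
  note S = calg_tab vec2_eq_iff tab_nth e_nth
  have n1: "\<not> (\<forall>x :: 'k^2. P x x = 0)" if "P e1 e1 \<noteq> 0" for P using that by blast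
  have n2: "\<not> (\<forall>x y :: 'k^2. P x y = P y x)" if "P e1 e2 \<noteq> P e2 e1" for P
    using that by blast
  have t: "\<not> two_nil P" if "\<And>x. P x x = 0 \<Longrightarrow> x$1 = 0" for P :: "'k^2 \<Rightarrow> _"
    using that unfolding two_nil_iff by auto
  have t2: "two_nil P" if "P x x = 0" "P y y = 0" "x$1 * y$2 \<noteq> x$2 * y$1" for x y and P :: "'k^2 \<Rightarrow> _"
    using that unfolding two_nil_iff by blast
  have c: "(1 :: 'k) \<noteq> -1" by (simp add: eq_neg_iff_add_eq_0)
  have tn: "\<not> two_nil (calg C01 :: 'k^2 \<Rightarrow> _)" "\<not> two_nil (calg C02 :: 'k^2 \<Rightarrow> _)"
    "\<not> two_nil (calg C03 :: 'k^2 \<Rightarrow> _)" "\<not> two_nil (calg C04 :: 'k^2 \<Rightarrow> _)"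
    "\<not> two_nil (calg (C10 a b) :: 'k^2 \<Rightarrow> _)" "\<not> two_nil (calg C07 :: 'k^2 \<Rightarrow> _)"
    by (intro t; (auto simp: S simp del: calg.simps; fail))+
  show "kind (calg C16 :: 'k^2 \<Rightarrow> _) = 0" "kind (calg (C17 a) :: 'k^2 \<Rightarrow> _) = 0"
    unfolding kind_def by (simp_all add: mm S del: calg.simps)
  show "kind (calg C06 :: 'k^2 \<Rightarrow> _) = 6"
  proof -
    have "\<forall>x :: 'k^2. calg C06 x x = 0" by (simp add: S algebra_simps del: calg.simps)
    then show ?thesis unfolding kind_def by (simp add: many del: calg.simps)
  qed
  show "kind (calg (C05 a) :: 'k^2 \<Rightarrow> _) = 5"
  proof -
    have "calg (C05 a) (vec2 1 1) (vec2 1 1) \<noteq> (0 :: 'k^2)" by (simp add: S del: calg.simps)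
    then have "\<not> (\<forall>x :: 'k^2. calg (C05 a) x x = 0)" by blast
    moreover have "two_nil (calg (C05 a) :: 'k^2 \<Rightarrow> _)"
      by (rule t2[of _ e1 e2]) (simp_all add: S del: calg.simps)
    ultimately show ?thesis unfolding kind_def by (simp add: many del: calg.simps)
  qed
  have "two_nil (calg C08 :: 'k^2 \<Rightarrow> _)" "two_nil (calg C09 :: 'k^2 \<Rightarrow> _)"
    by (rule t2[of _ "vec2 1 (-1)" e2]; simp add: S del: calg.simps)+
  moreover have "\<not> (\<forall>x :: 'k^2. calg C08 x x = 0)" "\<not> (\<forall>x :: 'k^2. calg C09 x x = 0)"
    by (rule n1; simp add: S del: calg.simps)+
  ultimately show "kind (calg C08 :: 'k^2 \<Rightarrow> _) = 5" "kind (calg C09 :: 'k^2 \<Rightarrow> _) = 5"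
    unfolding kind_def by (simp_all add: many del: calg.simps)
  show "kind (calg C07 :: 'k^2 \<Rightarrow> _) \<notin> {0, 5}" "a + b \<noteq> 1 \<Longrightarrow> kind (calg (C10 a b) :: 'k^2 \<Rightarrow> _) \<notin> {0, 5}"
    unfolding kind_def by (simp_all add: many tn del: calg.simps)
  have z: "\<not> (\<forall>x :: 'k^2. calg C01 x x = 0)" "\<not> (\<forall>x :: 'k^2. calg C02 x x = 0)"
     "\<not> (\<forall>x :: 'k^2. calg C03 x x = 0)" "\<not> (\<forall>x :: 'k^2. calg C04 x x = 0)"
    by (rule n1; simp add: S del: calg.simps)+
  have com: "\<not> (\<forall>x y :: 'k^2. calg C01 x y = calg C01 y x)" "\<not> (\<forall>x y :: 'k^2. calg C02 x y = calg C02 y x)"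
     "\<not> (\<forall>x y :: 'k^2. calg C03 x y = calg C03 y x)"
    by (rule n2; simp add: S c eq_neg_iff_add_eq_0 del: calg.simps)+
  have "\<forall>x y :: 'k^2. calg C04 x y = calg C04 y x" by (simp add: S mult.commute del: calg.simps)
  then show "kind (calg C04 :: 'k^2 \<Rightarrow> _) = 4" unfolding kind_def
    by (simp add: many tn z del: calg.simps)
  have "\<exists>x :: 'k^2. x \<noteq> 0 \<and> (\<forall>y. calg C01 x y = 0)"
    by (rule exI[of _ e2]) (simp add: S del: calg.simps)
  then show "kind (calg C01 :: 'k^2 \<Rightarrow> _) = 1" unfolding kind_def
    by (simp add: many tn z com del: calg.simps)
  have "x = 0" if "\<forall>y. calg C02 x y = 0" for x :: "'k^2"
    using that[rule_format, of e1] by (auto simp: S simp del: calg.simps)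
  moreover have "x = 0" if "\<forall>y. calg C03 x y = 0" for x :: "'k^2"
    using that[rule_format, of e1] that[rule_format, of e2] by (auto simp: S simp del: calg.simps)
  ultimately have la: "\<not> (\<exists>x :: 'k^2. x \<noteq> 0 \<and> (\<forall>y. calg C02 x y = 0))"
    "\<not> (\<exists>x :: 'k^2. x \<noteq> 0 \<and> (\<forall>y. calg C03 x y = 0))" by blast+
  have "\<not> (\<forall>x :: 'k^2. calg C02 (calg C02 x x) (calg C02 x x) = 0)"
    by (auto intro!: exI[of _ e1] simp: S simp del: calg.simps)
  then show "kind (calg C02 :: 'k^2 \<Rightarrow> _) = 2" unfolding kind_def
    by (simp only: many tn z com la if_False)
  have "\<forall>x :: 'k^2. calg C03 (calg C03 x x) (calg C03 x x) = 0"
    by (simp add: S del: calg.simps)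
  then show "kind (calg C03 :: 'k^2 \<Rightarrow> _) = 3" unfolding kind_def
    by (simp only: many tn z com la if_False if_True simp_thms)
qed

lemma nil_types_C05: "nil_types (calg (C05 a) :: 'k::field^2 \<Rightarrow> _) = {a}"
proof (intro equalityI subsetI)
  fix m assume "m \<in> nil_types (calg (C05 a) :: 'k^2 \<Rightarrow> _)"
  then obtain v w :: "'k^2" where v: "v \<noteq> 0" "calg (C05 a) v v = 0" "calg (C05 a) w w = 0"
    "calg (C05 a) v w = (1 - m) *s v" "calg (C05 a) w v = m *s v"
    unfolding nil_types_def by blast
  note v = v[unfolded calg_tab vec2_eq_iff tab_nth, simplified]
  show "m \<in> {a}"
  \<comment> \<open>All products lie on the line of \<open>e1\<close>. As \<open>1 - m\<close> and
    \<open>m\<close> are not both zero, \<open>v\<close> lies there too.\<close>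
  proof (cases "v$2 = 0")
    case True
    then have "v$1 \<noteq> 0" using v by auto
    have "v$1 * (w$2 * (1 - a)) = v$1 * (1 - m)" "v$1 * (w$2 * a) = v$1 * m"
      using v True by (simp_all add: algebra_simps)
    then have "w$2 * (1 - a) = 1 - m" "w$2 * a = m" using \<open>v$1 \<noteq> 0\<close> by simp_all
    then have "w$2 = 1" by (simp add: algebra_simps)
    then show ?thesis using \<open>w$2 * a = m\<close> by simp
  qed (use v in auto)
next
  fix m assume "m \<in> {a}"
  then have "e1 \<noteq> 0 \<and> calg (C05 a) e1 e1 = 0 \<and> calg (C05 a) e2 e2 = 0 \<and>
      calg (C05 a) e1 e2 = (1 - m) *s e1 \<and> calg (C05 a) e2 e1 = m *s (e1 :: 'k^2)"
    unfolding calg_tab vec2_eq_iff tab_nth by (simp add: e_nth)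
  then show "m \<in> nil_types (calg (C05 a) :: 'k^2 \<Rightarrow> _)"
    unfolding nil_types_def by blast
qed

section \<open>Separating the listed algebras\<close>

lemma in_inversion_reps:
  assumes "inversion_reps K" "a \<in> K"
  shows "a \<noteq> 0" "a \<noteq> 1" "inverse a \<in> K \<Longrightarrow> inverse a = a"
proof -
  have K: "K \<subseteq> UNIV - {0, 1}" "\<forall>x\<in>UNIV - {0, 1}. \<exists>!r. r \<in> K \<and> r \<in> {x, inverse x}"
    using assms(1) unfolding inversion_reps_def orbit_reps_def by auto
  then have a: "a \<in> UNIV - {0, 1}" using assms(2) by blast
  then show "a \<noteq> 0" "a \<noteq> 1" by auto
  show "inverse a \<in> K \<Longrightarrow> inverse a = a" using K(2)[rule_format, OF a] assms(2) by blast
qed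

lemma inverse_eq_self: "inverse a = a \<Longrightarrow> a \<noteq> 0 \<Longrightarrow> a \<noteq> 1 \<Longrightarrow> a = (-1 :: 'k::field)"
proof -
  assume a: "inverse a = a" "a \<noteq> 0" "a \<noteq> 1"
  then have "a * a = 1" using right_inverse[of a] by simp
  then have "(a - 1) * (a + 1) = 0" by (simp add: algebra_simps)
  then show "a = -1" using a(3) by (simp add: eq_neg_iff_add_eq_0)
qed

text \<open>\<open>calC3\<close> takes the same value at \<open>(0, a, b, 0)\<close> and
  \<open>(0, b, a, 0)\<close>, so the two triples lie in one orbit. Having a single representative
  there, they are equal, and their first entries are \<open>(a, 0)\<close> and
  \<open>(b, 0)\<close>.\<close>

lemma calV_swap_eq:
  assumes W: "triple_reps W" and "(0, a, b, 0) \<in> calV W" "(0, b, a, 0) \<in> calV W"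
  shows "a = b"
proof -
  let ?t = "triple_of (0, a, b, 0)" and ?u = "triple_of (0, b, a, 0)"
  have t: "?t \<in> W" "?u \<in> W" using assms(2,3) by (auto simp: calV_def)
  then have "?t \<in> triple_of ` generic_params" using W unfolding triple_reps_def orbit_reps_def by blast
  moreover have "?t \<in> orb3 ?t" "?u \<in> orb3 ?t"
    by (auto simp: triple_of_def mult.commute)
  ultimately have "?t = ?u" using W t unfolding triple_reps_def orbit_reps_def by blast
  then have "fst ?t = fst ?u" by (rule arg_cong)
  then show "a = b" by (simp add: triple_of_def)
qed

lemma calV_C11:
  assumes "(0, a, b, 0) \<in> calV W"
  shows "a \<noteq> 1" "b \<noteq> 1" "a * b \<noteq> 1"
  using assms by (auto simp: calV_def calT_def mult.commute)

text \<open>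
  Splitting by the second component makes the types comparable by simplification: no listed label
  has more than one type in the second set, and only \<open>C11\<close> and \<open>C13\<close> have two in the first.
\<close>

definition zero_types :: "('k::field ^ 2 \<Rightarrow> 'k ^ 2 \<Rightarrow> 'k ^ 2) \<Rightarrow> 'k set" where
  "zero_types P = {l. (l, 0) \<in> idempotent_types P}"

definition nonzero_types :: "('k::field ^ 2 \<Rightarrow> 'k ^ 2 \<Rightarrow> 'k ^ 2) \<Rightarrow> ('k \<times> 'k) set" where
  "nonzero_types P = {p \<in> idempotent_types P. snd p \<noteq> 0}"

fun label_zero_types :: "'k::field label \<Rightarrow> 'k set" where
  "label_zero_types C07 = {1}"
| "label_zero_types C08 = {0}"
| "label_zero_types (C10 a b) = (if b = 0 then {a} else {})"
| "label_zero_types (C11 a b) = {a, b}"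
| "label_zero_types (C12 a) = {1}"
| "label_zero_types (C13 a) = {a, 1}"
| "label_zero_types (C14 a) = {a}"
| "label_zero_types (C15 a) = {1 / a}"
| "label_zero_types (C17 a) = (if a = 1 then {1} else {})"
| "label_zero_types _ = {}"

fun label_nonzero_types :: "'k::field label \<Rightarrow> ('k \<times> 'k) set" where
  "label_nonzero_types C09 = {(1, -1)}"
| "label_nonzero_types (C10 a b) = (if b = 0 then {} else {(a, b)})"
| "label_nonzero_types (C11 a b) = {(1, - ((a - 1) * (b - 1)) / (a * b - 1))}"
| "label_nonzero_types (C12 a) = {(1, a)}"
| "label_nonzero_types (C14 a) = {(1, (1 - a) / a)}"
| "label_nonzero_types (C15 a) = {(1, a - 1)}"
| "label_nonzero_types C16 = {(0, -1)}"
| "label_nonzero_types (C17 a) = (if a = 1 then {} else {(a, 1 - a)})"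
| "label_nonzero_types _ = {}"

lemma label_types:
  fixes K :: "'k::field_char_0 set"
  assumes K: "inversion_reps K" and l: "listed K W l"
  shows "zero_types (calg l) = label_zero_types l \<and> nonzero_types (calg l) = label_nonzero_types l"
proof (cases l)
  case (C10 a b)
  then have "a + b \<noteq> 1" using l by (auto simp: calT_def)
  then show ?thesis using C10
    by (auto simp: zero_types_def nonzero_types_def idempotent_types_calg simp del: calg.simps)
next
  case (C11 a b)
  then have "a \<noteq> 1" "b \<noteq> 1" "a * b \<noteq> 1" using l calV_C11[of a b W] by auto
  then show ?thesis using C11
    by (auto simp: zero_types_def nonzero_types_def idempotent_types_C11 simp del: calg.simps)
next
  case (C14 a)
  then show ?thesis using l in_inversion_reps[OF K, of a]
    by (auto simp: zero_types_def nonzero_types_def idempotent_types_calg simp del: calg.simps)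
next
  case (C15 a)
  then show ?thesis using l in_inversion_reps[OF K, of a]
    by (auto simp: zero_types_def nonzero_types_def idempotent_types_calg simp del: calg.simps)
qed (use l in \<open>auto simp: zero_types_def nonzero_types_def idempotent_types_calg idempotent_types_calg_C01_C06 simp del: calg.simps\<close>)

lemma iso_C14_C15: "algebra_iso (*s) (calg (C14 (-1))) (*s) (calg (C15 (-1)) :: 'k::field_char_0 ^ 2 \<Rightarrow> _)"
  using algebra_iso_swap[of 1 0 0 1 "-1" "(1 - (-1))/(-1)" 0 "1 :: 'k"]
  unfolding calg_tab by simp

lemma iso_listed_imp:
  fixes K :: "'k::field_char_0 set"
  assumes K: "inversion_reps K" and W: "triple_reps W"
    and l: "listed K W l" "listed K W l'" and iso: "algebra_iso (*s) (calg l) (*s) (calg l')"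
  shows "l = l' \<or> {l, l'} = {C14 (-1), C15 (-1)}"
proof -
  have T: "idempotent_types (calg l) = idempotent_types (calg l')" and N: "nil_types (calg l) = nil_types (calg l')"
    and k: "kind (calg l) = kind (calg l')"
    using invariants_iso[OF iso] by blast+
  have Z: "label_zero_types l = label_zero_types l'" "label_nonzero_types l = label_nonzero_types l'"
    using label_types[OF K l(1)] label_types[OF K l(2)] T unfolding zero_types_def nonzero_types_def by auto
  have c: "(1 :: 'k) \<noteq> -1" "(-1 :: 'k) \<noteq> 1"
    by (simp_all add: eq_neg_iff_add_eq_0 neg_eq_iff_add_eq_0)
  have K1: "a \<noteq> 0 \<and> a \<noteq> 1" if "a \<in> K" for a using in_inversion_reps[OF K that] by blast
  have V: "a \<noteq> 1 \<and> b \<noteq> 1 \<and> a * b \<noteq> 1" if "(0, a, b, 0) \<in> calV W" for a b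
    using calV_C11[OF that] by blast
  \<comment> \<open>\<open>C14 a\<close> and \<open>C15 b\<close> have the same types exactly for
    \<open>a = 1 / b\<close>. Both parameters lie in \<open>K\<close> only at the fixed point
    \<open>-1\<close> of inversion.\<close>
  have K2: "a = -1 \<and> b = -1" if "a = 1 / b" "a \<in> K" "b \<in> K" for a b
  proof -
    have "a = inverse b" using that by (simp add: inverse_eq_divide)
    then have "inverse b = b" using in_inversion_reps(3)[OF K that(3)] that by simp
    then show ?thesis using inverse_eq_self K1 that(3) \<open>a = inverse b\<close> by metis
  qed
  have kn: "kind (calg C07 :: 'k^2 \<Rightarrow> _) \<noteq> 0" "kind (calg C07 :: 'k^2 \<Rightarrow> _) \<noteq> 5"
    "a + b \<noteq> 1 \<Longrightarrow> kind (calg (C10 a b) :: 'k^2 \<Rightarrow> _) \<noteq> 0"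
    "a + b \<noteq> 1 \<Longrightarrow> kind (calg (C10 a b) :: 'k^2 \<Rightarrow> _) \<noteq> 5" for a b :: 'k
    using kind_calg(11) kind_calg(12)[of a b] by auto
  note kk = kind_calg(1-10) kn kn[symmetric]
  \<comment> \<open>The first equation forces \<open>a = b = d\<close>; then
    \<open>- (d - 1) / (d + 1)\<close> would have to equal \<open>(1 - d) / d\<close>, which is
    impossible for \<open>d \<noteq> 1\<close>.\<close>
  have C11_C14: False
    if "{a, b} = {d}" "{(1 :: 'k, - ((a - 1) * (b - 1)) / (a * b - 1))} = {(1, (1 - d) / d)}"
      "(0, a, b, 0) \<in> calV W" "d \<noteq> 0" for a b d
  proof -
    have d: "a = d" "b = d" "d \<noteq> 1" "d * d - 1 \<noteq> 0" using that(1) V[OF that(3)] by auto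
    have "- ((d - 1) * (d - 1)) / (d * d - 1) = (1 - d) / d" using that(2) d by simp
    then have "- ((d - 1) * (d - 1)) * d = (1 - d) * (d * d - 1)"
      using frac_eq_eq[OF d(4) that(4)] by blast
    then have "(d - 1) * (d - 1) = 0" by algebra
    then show False using d by simp
  qed
  \<comment> \<open>\<open>C15 d\<close> has the types of \<open>C14 (1 / d)\<close>, so this
    reduces to the previous case.\<close>
  have C11_C15: False
    if "{a, b} = {1 / d}" "{(1 :: 'k, - ((a - 1) * (b - 1)) / (a * b - 1))} = {(1, d - 1)}"
      "(0, a, b, 0) \<in> calV W" "d \<noteq> 0" for a b d
  proof (rule C11_C14[OF that(1) _ that(3)])
    have "d - 1 = (1 - 1 / d) / (1 / d)" using that(4) by (simp add: field_simps)
    then show "{(1 :: 'k, - ((a - 1) * (b - 1)) / (a * b - 1))} = {(1, (1 - 1 / d) / (1 / d))}"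
      using that(2) by simp
  qed (use that(4) in simp)
  have C11_C11: "a = a' \<and> b = b'"
    if "{a, b} = {a', b'}" "(0, a, b, 0) \<in> calV W" "(0, a', b', 0) \<in> calV W" for a b a' b'
    using that calV_swap_eq[OF W] by (auto simp: doubleton_eq_iff)
  have C14_C15: "{C14 a, C15 b} = {C14 (-1), C15 (-1)}" if "{a} = {1 / b}" "a \<in> K" "b \<in> K" for a b
    using K2[of a b] that by simp
  \<comment> \<open>The split types and the kinds settle most pairs of labels; the nil types in
    \<open>N\<close> are there for a pair of \<open>C05\<close> labels. The pairs left over have
    parameters restricted by \<open>W\<close> or \<open>K\<close>.\<close>
  show ?thesis
    apply (cases l; cases l'; insert Z k l;
        simp only: label_zero_types.simps label_nonzero_types.simps kk listed.simps
          label.inject label.distinct simp_thms;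
        (simp add: c; fail)?;
        (insert N; simp add: c calT_def nil_types_C05 kk doubleton_eq_iff del: calg.simps
          split: if_splits; fail)?)
    \<comment> \<open>left: 11-11, 11-14, 11-15, 14-11, 14-15, 15-11, 15-14\<close>
    subgoal by (rule disjI1, rule C11_C11; assumption)
    subgoal by (rule FalseE, rule C11_C14; (assumption | rule K1[THEN conjunct1]))
    subgoal by (rule FalseE, rule C11_C15; (assumption | rule K1[THEN conjunct1]))
    subgoal by (rule FalseE, rule C11_C14[OF sym sym]; (assumption | rule K1[THEN conjunct1]))
    subgoal by (rule C14_C15; assumption)
    subgoal by (rule FalseE, rule C11_C15[OF sym sym]; (assumption | rule K1[THEN conjunct1]))
    subgoal by (subst insert_commute, rule C14_C15[OF sym]; assumption)
    done
qed

theorem theorem11: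
  fixes K :: "'k::{alg_closed_field, field_char_0} set"
    and W :: "'k triple set"
  assumes "inversion_reps K"
    and "triple_reps W"
  shows "(adapted_reps W \<longrightarrow>
      (\<forall>(scale :: 'k \<Rightarrow> 'v::ab_group_add \<Rightarrow> 'v) P.
        algebra_on scale P \<and> vector_space.dim scale (UNIV :: 'v set) = 2 \<and>
        conservative scale P \<and> (\<exists>x y. P x y \<noteq> 0) \<longrightarrow>
        (\<exists>l. listed K W l \<and> algebra_iso scale P (*s) (calg l)) \<or>
        algebra_iso scale P (*s) alg_omitted)) \<and>
    (\<forall>l l'. listed K W l \<and> listed K W l' \<longrightarrow>
      (algebra_iso (*s) (calg l) (*s) (calg l') \<longleftrightarrow> l = l' \<or> {l, l'} = {C14 (-1), C15 (-1)}))"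
proof (intro conjI impI allI)
  fix scale :: "'k \<Rightarrow> 'v \<Rightarrow> 'v" and P
  assume "adapted_reps W" and "algebra_on scale P \<and> vector_space.dim scale (UNIV :: 'v set) = 2 \<and>
    conservative scale P \<and> (\<exists>x y. P x y \<noteq> 0)"
  then show "(\<exists>l. listed K W l \<and> algebra_iso scale P (*s) (calg l)) \<or> algebra_iso scale P (*s) alg_omitted"
    using classification_exists assms(1) by blast
next
  fix l l' assume l: "listed K W l \<and> listed K W l'"
  have refl: "algebra_iso (*s) (calg l) (*s) (calg l)"
  proof -
    have "bij (\<lambda>x. x)" by (simp add: bij_def)
    then show ?thesis unfolding algebra_iso_def using vec.linear_ident by blast
  qed
  show "algebra_iso (*s) (calg l) (*s) (calg l') \<longleftrightarrow> l = l' \<or> {l, l'} = {C14 (-1), C15 (-1)}"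
  proof
    assume "algebra_iso (*s) (calg l) (*s) (calg l')"
    then show "l = l' \<or> {l, l'} = {C14 (-1), C15 (-1)}" using iso_listed_imp assms l by blast
  next
    assume "l = l' \<or> {l, l'} = {C14 (-1), C15 (-1)}"
    then consider "l = l'" | "l = C14 (-1)" "l' = C15 (-1)" | "l' = C14 (-1)" "l = C15 (-1)"
      by (auto simp: doubleton_eq_iff)
    then show "algebra_iso (*s) (calg l) (*s) (calg l')"
      using refl iso_C14_C15 algebra_iso_sym[OF iso_C14_C15] by cases (simp_all del: calg.simps)
  qed
qed

end
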